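(* Consider the maximum likelihood estimators $\hat\beta_n$ and $\hat h_n$ of the four-spin interaction mean-field model with true parameter $(\beta,h)$, $\beta>0$, $h\in\mathbb R$. If $(\beta,h)\in R_2$ (defined in the context), then as $n\to\infty$ $$\sqrt n(\hat\beta_n-\beta)\to U_\beta,\qquad\sqrt n(\hat h_n-h)\to U_h\qquad\text{in law},$$ where $U_\beta$ and $U_h$ have the mixture laws $$U_\beta=p_\beta^-N^-(0,\sigma_\beta^-)+p_\beta^+N^+(0,\sigma_\beta^+)+(1-p_\beta^--p_\beta^+)\delta_0,$$ $$U_h=p_h^-N^-(0,\sigma_h^-)+p_h^+N^+(0,\sigma_h^+)+(1-p_h^--p_h^+)\delta_0,$$ with $p_\beta^\pm,\sigma_\beta^\pm,p_h^\pm,\sigma_h^\pm$ positive constants.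
   Context: For $\omega\in\{1,-1\}^n$ let $\bar\omega_+=|\{i:\omega_i=1\}|/n$. The four-spin model is $\mu_n(\omega)\propto\exp(nf_{\beta,h}(\bar\omega_+))$ on $\{1,-1\}^n$, with $f_{\beta,h}(a)=\beta(2a-1)^4+h(2a-1)^2$. Let $I(a)=-a\log a-(1-a)\log(1-a)$ on $[0,1]$ ($0\log0=0$) and $A=f_{\beta,h}+I$. There is a function $g:(0,\infty)\to\mathbb R$, with $g(\beta)=1/2$ for $\beta\le1/12$, such that: for $h<g(\beta)$, $A$ has the unique maximizer $1/2$; for $h>g(\beta)$, $A$ has exactly two maximizers $0<a_-<1/2<a_+<1$, with $A''(a_\pm)<0$; for $h=g(\beta)$, $1/2$ is a maximizer of $A$. $R_2=\{(\beta,h):\beta>0,\ h>g(\beta)\}$. MLEs: each parameter is estimated from one sample $\omega\sim\mu_n$ with the other known; $\hat\beta_n$ is the solution $x$ of $\mathbb E_{x,h}[(2\bar\omega_+-1)^4]=(2\bar\omega_+-1)^4$ and $\hat h_n$ the solution $x$ of $\mathbb E_{\beta,x}[(2\bar\omega_+-1)^2]=(2\bar\omega_+-1)^2$, where $\mathbb E_{\beta,h}$ is expectation under the measure with parameters $(\beta,h)$. $N^+(0,\sigma)$ and $N^-(0,\sigma)$ are the laws of $|Z|$ and $-|Z|$ where $Z$ is centered normal with variance $\sigma$. *)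

theory Defs
  imports "HOL-Probability.Probability"
begin

definition spins :: "nat \<Rightarrow> (nat \<Rightarrow> int) set" where
  "spins n = ({..<n} \<rightarrow>\<^sub>E {1, -1})"

definition frac_plus :: "nat \<Rightarrow> (nat \<Rightarrow> int) \<Rightarrow> real" where
  "frac_plus n \<omega> = real (card {i \<in> {..<n}. \<omega> i = 1}) / real n"

definition magnetization :: "nat \<Rightarrow> (nat \<Rightarrow> int) \<Rightarrow> real" where
  "magnetization n \<omega> = 2 * frac_plus n \<omega> - 1"

definition four_spin_f :: "real \<Rightarrow> real \<Rightarrow> real \<Rightarrow> real" where
  "four_spin_f \<beta> h a = \<beta> * (2 * a - 1) ^ 4 + h * (2 * a - 1) ^ 2"

definition gibbs_weight :: "nat \<Rightarrow> real \<Rightarrow> real \<Rightarrow> (nat \<Rightarrow> int) \<Rightarrow> real" where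
  "gibbs_weight n \<beta> h \<omega> = exp (real n * four_spin_f \<beta> h (frac_plus n \<omega>))"

definition four_spin_measure :: "nat \<Rightarrow> real \<Rightarrow> real \<Rightarrow> (nat \<Rightarrow> int) measure" where
  "four_spin_measure n \<beta> h = point_measure (spins n)
     (\<lambda>\<omega>. ennreal (gibbs_weight n \<beta> h \<omega> / (\<Sum>\<eta>\<in>spins n. gibbs_weight n \<beta> h \<eta>)))"

(* The convention 0 log 0 = 0 is automatic, since ln 0 is a real number. *)
definition entropy_fn :: "real \<Rightarrow> real" where
  "entropy_fn a = - a * ln a - (1 - a) * ln (1 - a)"

definition free_energy :: "real \<Rightarrow> real \<Rightarrow> real \<Rightarrow> real" where
  "free_energy \<beta> h a = four_spin_f \<beta> h a + entropy_fn a"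

definition maximizers :: "real \<Rightarrow> real \<Rightarrow> real set" where
  "maximizers \<beta> h = {a. is_arg_max (free_energy \<beta> h) (\<lambda>a. a \<in> {0..1}) a}"

(* The threshold is a function on (0,\<infinity>); its values at nonpositive arguments are
   irrelevant.  On (0,\<infinity>) the conditions determine g uniquely. *)
definition phase_threshold :: "(real \<Rightarrow> real) \<Rightarrow> bool" where
  "phase_threshold g \<longleftrightarrow>
     (\<forall>\<beta>>0. \<beta> \<le> 1 / 12 \<longrightarrow> g \<beta> = 1 / 2) \<and>
     (\<forall>\<beta>>0. \<forall>h.
        (h < g \<beta> \<longrightarrow> maximizers \<beta> h = {1 / 2}) \<and>
        (h > g \<beta> \<longrightarrow> (\<exists>am ap. 0 < am \<and> am < 1 / 2 \<and> 1 / 2 < ap \<and> ap < 1 \<and>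
            maximizers \<beta> h = {am, ap} \<and>
            deriv (deriv (free_energy \<beta> h)) am < 0 \<and>
            deriv (deriv (free_energy \<beta> h)) ap < 0)) \<and>
        (h = g \<beta> \<longrightarrow> 1 / 2 \<in> maximizers \<beta> h))"

definition R2 :: "(real \<Rightarrow> real) \<Rightarrow> (real \<times> real) set" where
  "R2 g = {(\<beta>, h). \<beta> > 0 \<and> h > g \<beta>}"

definition mle_eq_beta :: "nat \<Rightarrow> real \<Rightarrow> (nat \<Rightarrow> int) \<Rightarrow> real \<Rightarrow> bool" where
  "mle_eq_beta n h \<omega> x \<longleftrightarrow>
     (\<integral>\<eta>. magnetization n \<eta> ^ 4 \<partial>four_spin_measure n x h) = magnetization n \<omega> ^ 4"

definition mle_eq_h :: "nat \<Rightarrow> real \<Rightarrow> (nat \<Rightarrow> int) \<Rightarrow> real \<Rightarrow> bool" where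
  "mle_eq_h n \<beta> \<omega> x \<longleftrightarrow>
     (\<integral>\<eta>. magnetization n \<eta> ^ 2 \<partial>four_spin_measure n \<beta> x) = magnetization n \<omega> ^ 2"

(* For extreme samples (e.g. all spins equal) the likelihood equation has no finite
   solution, and for n = 1 every x solves it.  An estimator has to equal the solution
   whenever there is exactly one; its value on the remaining samples is arbitrary. *)
definition is_mle_beta :: "real \<Rightarrow> (nat \<Rightarrow> (nat \<Rightarrow> int) \<Rightarrow> real) \<Rightarrow> bool" where
  "is_mle_beta h bhat \<longleftrightarrow>
     (\<forall>n. \<forall>\<omega>\<in>spins n. (\<exists>!x. mle_eq_beta n h \<omega> x) \<longrightarrow> mle_eq_beta n h \<omega> (bhat n \<omega>))"

definition is_mle_h :: "real \<Rightarrow> (nat \<Rightarrow> (nat \<Rightarrow> int) \<Rightarrow> real) \<Rightarrow> bool" where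
  "is_mle_h \<beta> hhat \<longleftrightarrow>
     (\<forall>n. \<forall>\<omega>\<in>spins n. (\<exists>!x. mle_eq_h n \<beta> \<omega> x) \<longrightarrow> mle_eq_h n \<beta> \<omega> (hhat n \<omega>))"

(* The parameter v is the variance of the underlying normal variable Z,
   whereas normal_density takes the standard deviation. *)
definition centered_normal :: "real \<Rightarrow> real measure" where
  "centered_normal v = density lborel (\<lambda>x. ennreal (normal_density 0 (sqrt v) x))"

definition half_normal_pos :: "real \<Rightarrow> real measure" where
  "half_normal_pos v = distr (centered_normal v) borel (\<lambda>z. \<bar>z\<bar>)"

definition half_normal_neg :: "real \<Rightarrow> real measure" where
  "half_normal_neg v = distr (centered_normal v) borel (\<lambda>z. - \<bar>z\<bar>)"

definition half_normal_mixture :: "real \<Rightarrow> real \<Rightarrow> real \<Rightarrow> real \<Rightarrow> real measure" where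
  "half_normal_mixture pm vm pp vp = measure_of UNIV (sets borel)
     (\<lambda>B. ennreal pm * emeasure (half_normal_neg vm) B
        + ennreal pp * emeasure (half_normal_pos vp) B
        + ennreal (1 - pm - pp) * emeasure (return borel 0) B)"

lemma emeasure_half_normal_mixture:
  assumes "B \<in> sets borel"
  shows "emeasure (half_normal_mixture pm vm pp vp) B =
      ennreal pm * emeasure (half_normal_neg vm) B
    + ennreal pp * emeasure (half_normal_pos vp) B
    + ennreal (1 - pm - pp) * emeasure (return borel 0) B" (is "_ = ?m B")
proof (rule emeasure_measure_of[OF half_normal_mixture_def])
  have s: "sets (half_normal_mixture pm vm pp vp) = sets borel"
    unfolding half_normal_mixture_def
    by (metis sets.sets_measure_of_eq space_borel)
  show "sets borel \<subseteq> Pow (UNIV :: real set)" by simp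
  show "B \<in> sets (half_normal_mixture pm vm pp vp)" using assms s by simp
  show "positive (sets (half_normal_mixture pm vm pp vp)) ?m"
    by (simp add: positive_def)
  show "countably_additive (sets (half_normal_mixture pm vm pp vp)) ?m"
  proof (rule countably_additiveI)
    fix A :: "nat \<Rightarrow> real set"
    assume A: "range A \<subseteq> sets (half_normal_mixture pm vm pp vp)" "disjoint_family A"
    have "(\<Sum>i. emeasure N (A i)) = emeasure N (\<Union>i. A i)" if "sets N = sets borel" for N
      by (rule suminf_emeasure) (use A s that in auto)
    then show "(\<Sum>i. ?m (A i)) = ?m (\<Union>i. A i)"
      by (simp add: suminf_add[symmetric] half_normal_neg_def half_normal_pos_def)
  qed
qed

end

theory Submission
  imports Defs "HOL-Real_Asymp.Real_Asymp"
begin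

text \<open>
  In \<open>R2\<close> the two maximizers of the free energy are exchanged by \<open>a \<mapsto> 1 - a\<close>, and the statistic
  \<open>\<phi> = (2 a - 1) ^ 4\<close> (or \<open>(2 a - 1)\<^sup>2\<close>) takes the same value at both. Hence
  \<open>X = sqrt n * (\<phi> - \<phi> p)\<close> is asymptotically centered normal with some variance \<open>s > 0\<close>. Moving the parameter by
  \<open>t / sqrt n\<close> tilts the measure by \<open>exp (t * X)\<close>, so the expectation of \<open>X\<close> at that parameter tends to
  \<open>s * t\<close>. It is strictly increasing in \<open>t\<close>, so the estimator is at most \<open>t / sqrt n\<close> above the true
  parameter iff \<open>X\<close> is at most this expectation, and the limit law is centered normal with variance \<open>1 / s\<close>, that is,
  the mixture with \<open>p\<^sup>- = p\<^sup>+ = 1 / 2\<close> and equal variances.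

  Both asymptotic statements are obtained from one expansion for complex tilts \<open>exp (z * X)\<close>, which follows from Stein's
  identity for the binomial weights together with a large deviation bound away from the maximizers.
\<close>

section \<open>Entropy bounds for binomial coefficients\<close>

text \<open>No sharp Stirling asymptotics are needed. The entropy bounds lose polynomial factors,
  which is harmless because they only serve to compare the mass away from the wells with one term
  near \<open>p\<close>, and there the loss is exponential. All finer information comes from
  detailed balance, expanded to first order at \<open>p\<close>. The obstacle is the second well,
  where this linearization is false. Test functions are therefore cut off at 1/2 by
  \<open>right\<close>: the jump of the cut-off is felt only where the mass is negligible, and
  reflection recovers the full sums. The test function \<open>right a * (a - p)\<close> controls the
  second moment, and with that bound the test function \<open>right\<close> yields a linear relation
  between first moment and mass, whose slope is the variance. Errors for a complex tilt
  \<open>z\<close> are measured in absolute value, that is, with the positive weights of tilt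
  \<open>Re z\<close>; hence one real second moment estimate serves the real and the imaginary axis
  alike.\<close>

lemma ln_fact_lower: "real n * ln (real n) - real n \<le> ln (fact n)"
proof (induction n)
  case 0 show ?case by simp
next
  case (Suc n)
  show ?case
  proof (cases "n = 0")
    case False
    have "ln (real (Suc n) / real n) \<le> real (Suc n) / real n - 1"
      using False by (intro ln_le_minus_one) simp
    hence "real n * (ln (real (Suc n)) - ln (real n)) \<le> 1"
      using False by (simp add: ln_div field_simps)
    moreover have "ln (fact (Suc n)) = ln (real (Suc n)) + ln (fact n)"
      by (simp add: ln_mult del: of_nat_Suc)
    ultimately show ?thesis using Suc by (simp add: algebra_simps)
  qed simp
qed

lemma ln_fact_upper:
  "n > 0 \<Longrightarrow> ln (fact n) \<le> real n * ln (real n) - real n + 1 + ln (real n)"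
proof (induction n rule: nat_induct_non_zero)
  case 1 show ?case by simp
next
  case (Suc n)
  have "ln (real n / real (Suc n)) \<le> real n / real (Suc n) - 1"
    using Suc by (intro ln_le_minus_one) simp
  hence "ln (real n) - ln (real (Suc n)) \<le> real n / real (Suc n) - 1"
    using Suc by (simp add: ln_div del: of_nat_Suc)
  hence "(ln (real n) - ln (real (Suc n))) * real (Suc n) \<le> (real n / real (Suc n) - 1) * real (Suc n)"
    by (rule mult_right_mono) simp
  hence "(ln (real n) - ln (real (Suc n))) * real (Suc n) \<le> -1"
    by (simp add: left_diff_distrib del: distrib_left_numeral)
  moreover have "ln (fact (Suc n)) = ln (real (Suc n)) + ln (fact n)"
    by (simp add: ln_mult del: of_nat_Suc)
  ultimately show ?case using Suc by (simp add: algebra_simps)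
qed

lemma mult_entropy_fn:
  assumes "0 < k" "k < n"
  shows "real n * entropy_fn (real k / real n)
           = real n * ln (real n) - real k * ln (real k) - real (n - k) * ln (real (n - k))"
proof -
  have "1 - real k / real n = real (n - k) / real n"
    using assms by (simp add: field_simps of_nat_diff)
  hence "real n * entropy_fn (real k / real n) =
      - real k * (ln (real k) - ln (real n)) - real (n - k) * (ln (real (n - k)) - ln (real n))"
    unfolding entropy_fn_def using assms by (simp add: ln_div right_diff_distrib)
  also have "\<dots> = (real k + real (n - k)) * ln (real n) - real k * ln (real k) - real (n - k) * ln (real (n - k))"
    by (simp add: algebra_simps)
  also have "real k + real (n - k) = real n" using assms by simp
  finally show ?thesis .
qed

text \<open>A binomial probability is at most 1: with success probability k/n, the k-th term of the
  expansion of \<open>(a + (1 - a)) ^ n\<close> is the binomial coefficient divided by the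
  right-hand side.\<close>

lemma binomial_le_exp_entropy:
  assumes "k \<le> n"
  shows "real (n choose k) \<le> exp (real n * entropy_fn (real k / real n))"
proof (cases "0 < k \<and> k < n")
  case True
  define a where "a = real k / real n"
  have a: "0 < a" "a < 1" using True by (auto simp: a_def)
  have "real (n choose k) * a ^ k * (1 - a) ^ (n - k) \<le> (\<Sum>j\<le>n. real (n choose j) * a ^ j * (1 - a) ^ (n - j))"
    by (rule member_le_sum[of k "{..n}" "\<lambda>j. real (n choose j) * a ^ j * (1 - a) ^ (n - j)"])
      (use assms a in auto)
  also have "\<dots> = 1" using binomial_ring[of a "1 - a" n] by simp
  finally have le: "real (n choose k) * (a ^ k * (1 - a) ^ (n - k)) \<le> 1" by (simp add: mult.assoc)
  have "a ^ k * (1 - a) ^ (n - k) = exp (real k * ln a + real (n - k) * ln (1 - a))"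
    using a by (simp add: exp_add exp_of_nat_mult)
  also have "real k * ln a + real (n - k) * ln (1 - a) = - (real n * entropy_fn a)"
  proof -
    have "real n * a = real k" "real n * (1 - a) = real (n - k)"
      using True by (auto simp: a_def field_simps of_nat_diff)
    hence "real k * ln a + real (n - k) * ln (1 - a) = real n * a * ln a + real n * (1 - a) * ln (1 - a)"
      by simp
    thus ?thesis by (simp add: entropy_fn_def algebra_simps)
  qed
  finally have "real (n choose k) * inverse (exp (real n * entropy_fn a)) \<le> 1"
    using le by (simp add: exp_minus)
  thus ?thesis by (simp add: field_simps flip: a_def)
next
  case False
  \<comment> \<open>At the endpoints both sides equal 1, by the convention 0 log 0 = 0.\<close>
  hence "k = 0 \<or> k = n" using assms by auto
  thus ?thesis by (cases "n = 0") (auto simp: entropy_fn_def)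
qed

text \<open>The two factorials in the denominator each contribute a loss \<open>1 + ln n\<close> on
  the logarithmic scale, which makes up the factor \<open>exp 2 * n ^ 2\<close>.\<close>

lemma binomial_ge_exp_entropy:
  assumes "0 < k" "k < n"
  shows "exp (real n * entropy_fn (real k / real n)) / (exp 2 * real n ^ 2) \<le> real (n choose k)"
proof -
  have c: "real (n choose k) = fact n / (fact k * fact (n - k))"
    using assms by (simp add: binomial_fact)
  have "ln (real (n choose k)) = ln (fact n) - ln (fact k) - ln (fact (n - k))"
    unfolding c by (simp add: ln_div ln_mult)
  moreover have "ln (fact n) \<ge> real n * ln (real n) - real n" by (rule ln_fact_lower)
  moreover have "ln (fact k) \<le> real k * ln (real k) - real k + 1 + ln (real k)"
    using assms by (intro ln_fact_upper)
  moreover have "ln (fact (n - k)) \<le> real (n - k) * ln (real (n - k)) - real (n - k) + 1 + ln (real (n - k))"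
    using assms by (intro ln_fact_upper) auto
  moreover have "ln (real k) \<le> ln (real n)" "ln (real (n - k)) \<le> ln (real n)"
    using assms by auto
  moreover have "real (n - k) = real n - real k" using assms by simp
  ultimately have "real n * entropy_fn (real k / real n) - 2 - 2 * ln (real n) \<le> ln (real (n choose k))"
    using mult_entropy_fn[OF assms] by linarith
  hence "exp (real n * entropy_fn (real k / real n) - 2 - 2 * ln (real n)) \<le> exp (ln (real (n choose k)))"
    by simp
  also have "exp (ln (real (n choose k))) = real (n choose k)" using assms by simp
  also have "exp (real n * entropy_fn (real k / real n) - 2 - 2 * ln (real n))
      = exp (real n * entropy_fn (real k / real n)) / (exp 2 * real n ^ 2)"
  proof -
    have "exp (2 * ln (real n)) = real n ^ 2" using assms by (simp add: exp_of_nat_mult[of 2, simplified])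
    thus ?thesis by (simp add: exp_diff)
  qed
  finally show ?thesis .
qed

section \<open>Weighted binomial sums with two symmetric wells\<close>

text \<open>
  The dominant values of \<open>f + entropy_fn\<close> are \<open>p\<close> and \<open>1 - p\<close>. The function in the assumption \<open>drift\<close> is
  \<open>a * (exp (A' a) - 1)\<close> with \<open>A = f + entropy_fn\<close>, so it vanishes at \<open>p\<close> with slope
  \<open>\<kappa> = p * A'' p\<close>. A single constant \<open>K\<close> serves for all bounds on the unit interval.
\<close>

locale double_well =
  fixes f f1 \<phi> \<phi>1 :: "real \<Rightarrow> real" and p \<kappa> K :: real
  assumes p: "1 / 2 < p" "p < 1"
    and \<kappa>: "\<kappa> < 0"
    and f_sym: "\<And>a. f (1 - a) = f a"
    and phi_sym: "\<And>a. \<phi> (1 - a) = \<phi> a"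
    and f_taylor: "\<And>a b. a \<in> {0..1} \<Longrightarrow> b \<in> {0..1} \<Longrightarrow> \<bar>f b - f a - (b - a) * f1 a\<bar> \<le> K * (b - a)\<^sup>2"
    and phi_taylor: "\<And>a b. a \<in> {0..1} \<Longrightarrow> b \<in> {0..1} \<Longrightarrow> \<bar>\<phi> b - \<phi> a - (b - a) * \<phi>1 a\<bar> \<le> K * (b - a)\<^sup>2"
    and f1_bound: "\<And>a. a \<in> {0..1} \<Longrightarrow> \<bar>f1 a\<bar> \<le> K"
    and phi_bound: "\<And>a. a \<in> {0..1} \<Longrightarrow> \<bar>\<phi> a\<bar> \<le> K"
    and phi1_bound: "\<And>a. a \<in> {0..1} \<Longrightarrow> \<bar>\<phi>1 a\<bar> \<le> K"
    and phi1_lipschitz: "\<And>a. a \<in> {0..1} \<Longrightarrow> \<bar>\<phi>1 a - \<phi>1 p\<bar> \<le> K * \<bar>a - p\<bar>"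
    and phi_p: "\<phi> p = 0"
    and phi1_p: "\<phi>1 p \<noteq> 0"
    and drift: "\<And>a. a \<in> {0..1} \<Longrightarrow> \<bar>(1 - a) * exp (f1 a) - a - \<kappa> * (a - p)\<bar> \<le> K * (a - p)\<^sup>2"
    and gap: "\<And>\<delta>. \<delta> > 0 \<Longrightarrow> \<exists>\<eta>>0. \<forall>a\<in>{0..1}. \<bar>a - p\<bar> \<ge> \<delta> \<longrightarrow> \<bar>a - (1 - p)\<bar> \<ge> \<delta> \<longrightarrow>
                f a + entropy_fn a \<le> f p + entropy_fn p - \<eta>"
    and cont: "isCont (\<lambda>a. f a + entropy_fn a) p"
begin

text \<open>One complex parameter covers both uses of the tilt: real \<open>z\<close> moves the
  model parameter, imaginary \<open>z\<close> produces the unnormalised characteristic function. The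
  modulus of \<open>wt\<close> is \<open>awt\<close> at \<open>Re z\<close>.\<close>

definition wt :: "nat \<Rightarrow> complex \<Rightarrow> nat \<Rightarrow> complex" where
  "wt n z k = of_nat (n choose k) *
     exp (of_real (real n * f (real k / real n)) + z * of_real (sqrt (real n) * \<phi> (real k / real n)))"

definition awt :: "nat \<Rightarrow> real \<Rightarrow> nat \<Rightarrow> real" where
  "awt n t k = real (n choose k) *
     exp (real n * f (real k / real n) + t * (sqrt (real n) * \<phi> (real k / real n)))"

definition Zr :: "nat \<Rightarrow> real \<Rightarrow> real" where
  "Zr n t = (\<Sum>k\<le>n. awt n t k)"

definition far :: "nat \<Rightarrow> real \<Rightarrow> nat \<Rightarrow> real" where
  "far n \<delta> k = (if \<bar>real k / real n - p\<bar> \<ge> \<delta> \<and> \<bar>real k / real n - (1 - p)\<bar> \<ge> \<delta> then 1 else 0)"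

text \<open>The midpoint 1/2 belongs to neither half, so that \<open>right a + right (1 - a)\<close>
  is 1 except there. This exception is absorbed by \<open>far\<close>.\<close>

definition right :: "real \<Rightarrow> real" where
  "right a = (if a > 1 / 2 then 1 else 0)"

lemma far_nonneg [simp]: "0 \<le> far n \<delta> k" by (simp add: far_def)
lemma right_bounds [simp]: "0 \<le> right a" "right a \<le> 1" by (auto simp: right_def)

lemma norm_wt: "norm (wt n z k) = awt n (Re z) k"
  by (simp add: wt_def awt_def norm_mult)

lemma wt_of_real: "wt n (of_real t) k = of_real (awt n t k)"
  unfolding wt_def awt_def
  by (simp only: of_real_mult[symmetric] of_real_add[symmetric] exp_of_real) simp

lemma awt_nonneg [simp]: "0 \<le> awt n t k"
  by (simp add: awt_def)

lemma Zr_pos: "0 < Zr n t"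
proof -
  have "awt n t 0 \<le> Zr n t" unfolding Zr_def by (rule member_le_sum) auto
  moreover have "0 < awt n t 0" by (simp add: awt_def)
  ultimately show ?thesis by linarith
qed

lemma K_nonneg: "0 \<le> K"
  using phi_bound[of 0] by simp

lemma frac_mem: "k \<le> n \<Longrightarrow> real k / real n \<in> {0..1}"
  by (cases "n = 0") (auto simp: field_simps)

text \<open>Entropy bounds compare each far term with a single term near \<open>p\<close>. The gap
  gains an exponential in n, while the tilt costs only an exponential in the square root of n. The
  decay is really exponential; the rate 1/n is what the later error terms require.\<close>

lemma far_sum_le:
  assumes "\<delta> > 0"
  obtains C where "C \<ge> 0" "\<And>n. n \<ge> 1 \<Longrightarrow> (\<Sum>k\<le>n. awt n t k * far n \<delta> k) \<le> C / real n * Zr n t"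
proof -
  define A where "A = (\<lambda>a. f a + entropy_fn a)"
  obtain \<eta> where \<eta>: "\<eta> > 0" "\<And>a. a \<in> {0..1} \<Longrightarrow> \<bar>a - p\<bar> \<ge> \<delta> \<Longrightarrow> \<bar>a - (1 - p)\<bar> \<ge> \<delta> \<Longrightarrow> A a \<le> A p - \<eta>"
    using gap[OF assms] unfolding A_def by blast
  \<comment> \<open>The tilt costs \<open>\<bar>t\<bar> * K * sqrt n\<close> twice, once in the far
    terms and once in the lower bound for \<open>Zr\<close>. Adding 1 keeps the constant positive
    when \<open>t\<close> is 0.\<close>
  define B where "B = 2 * (\<bar>t\<bar> * K) + 1"
  have B: "B > 0" using K_nonneg by (simp add: B_def add_nonneg_pos)
  define r where "r = (\<lambda>n::nat. real n * (exp 2 * (real n)\<^sup>2 * (real n + 1) * exp (B * sqrt (real n) - real n * \<eta> / 2)))"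
  have tilt: "\<bar>t * (sqrt (real n) * \<phi> (real k / real n))\<bar> \<le> \<bar>t\<bar> * K * sqrt (real n)" if "k \<le> n" for n k
    using mult_left_mono[OF phi_bound[OF frac_mem[OF that]], of "\<bar>t\<bar> * sqrt (real n)"]
    by (simp add: abs_mult ac_simps)
  have upper: "awt n t k * far n \<delta> k \<le> exp (real n * (A p - \<eta>) + \<bar>t\<bar> * K * sqrt (real n))" if "k \<le> n" for n k
  proof (cases "far n \<delta> k = 0")
    case False
    hence "A (real k / real n) \<le> A p - \<eta>"
      by (intro \<eta> frac_mem that) (auto simp: far_def split: if_splits)
    hence "real n * A (real k / real n) \<le> real n * (A p - \<eta>)" by (rule mult_left_mono) simp
    hence e: "real n * entropy_fn (real k / real n) + (real n * f (real k / real n) + t * (sqrt (real n) * \<phi> (real k / real n)))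
       \<le> real n * (A p - \<eta>) + \<bar>t\<bar> * K * sqrt (real n)"
      using tilt[OF that] unfolding A_def distrib_left by linarith
    have "awt n t k * far n \<delta> k \<le> awt n t k"
      by (simp add: far_def)
    also have "\<dots> \<le> exp (real n * entropy_fn (real k / real n)) * exp (real n * f (real k / real n) + t * (sqrt (real n) * \<phi> (real k / real n)))"
      unfolding awt_def by (intro mult_right_mono binomial_le_exp_entropy that) simp
    also have "\<dots> \<le> exp (real n * (A p - \<eta>) + \<bar>t\<bar> * K * sqrt (real n))"
      using e by (simp flip: exp_add)
    finally show ?thesis .
  qed simp
  \<comment> \<open>The comparison term sits at the grid point just below \<open>p\<close>. By
    continuity it loses at most \<open>\<eta> / 2\<close>, which leaves the other half of the
    gap.\<close>
  have k0: "(\<lambda>n. real (nat \<lfloor>real n * p\<rfloor>) / real n) \<longlonglongrightarrow> p"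
    using p by real_asymp
  have "(\<lambda>n. A (real (nat \<lfloor>real n * p\<rfloor>) / real n)) \<longlonglongrightarrow> A p"
    using cont k0 unfolding A_def by (rule isCont_tendsto_compose)
  hence "\<forall>\<^sub>F n in sequentially. A (real (nat \<lfloor>real n * p\<rfloor>) / real n) > A p - \<eta> / 2"
    by (rule order_tendstoD) (use \<eta> in simp)
  moreover have "\<forall>\<^sub>F n in sequentially. real (nat \<lfloor>real n * p\<rfloor>) / real n > 0"
    using k0 by (rule order_tendstoD) (use p in simp)
  moreover have "\<forall>\<^sub>F n in sequentially. real (nat \<lfloor>real n * p\<rfloor>) / real n < 1"
    using k0 by (rule order_tendstoD) (use p in simp)
  ultimately have ev: "\<forall>\<^sub>F n in sequentially. real n * (\<Sum>k\<le>n. awt n t k * far n \<delta> k) / Zr n t \<le> r n"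
    using eventually_gt_at_top[of 0]
  proof eventually_elim
    case (elim n)
    define k where "k = nat \<lfloor>real n * p\<rfloor>"
    have k: "0 < k" "k < n" using elim by (auto simp: k_def field_simps)
    have Ak: "real n * A (real k / real n) \<ge> real n * (A p - \<eta> / 2)"
      using elim by (intro mult_left_mono) (auto simp: k_def)
    have "exp (real n * (A p - \<eta> / 2) - \<bar>t\<bar> * K * sqrt (real n)) / (exp 2 * (real n)\<^sup>2)
        \<le> exp (real n * entropy_fn (real k / real n) + (real n * f (real k / real n) + t * (sqrt (real n) * \<phi> (real k / real n)))) / (exp 2 * (real n)\<^sup>2)"
      using Ak tilt[of k n] k unfolding A_def by (intro divide_right_mono) (simp_all add: distrib_left)
    also have "\<dots> = exp (real n * entropy_fn (real k / real n)) / (exp 2 * (real n)\<^sup>2) * exp (real n * f (real k / real n) + t * (sqrt (real n) * \<phi> (real k / real n)))"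
      by (simp add: exp_add)
    also have "\<dots> \<le> awt n t k"
      unfolding awt_def by (intro mult_right_mono binomial_ge_exp_entropy k) simp
    also have "\<dots> \<le> Zr n t"
      unfolding Zr_def by (rule member_le_sum) (use k in auto)
    finally have Z: "exp (real n * (A p - \<eta> / 2) - \<bar>t\<bar> * K * sqrt (real n)) \<le> exp 2 * (real n)\<^sup>2 * Zr n t"
      using elim by (simp add: field_simps)
    have "(\<Sum>k\<le>n. awt n t k * far n \<delta> k) \<le> (\<Sum>k\<le>n. exp (real n * (A p - \<eta>) + \<bar>t\<bar> * K * sqrt (real n)))"
      by (intro sum_mono upper) simp
    also have "\<dots> = (real n + 1) * exp (real n * (A p - \<eta>) + \<bar>t\<bar> * K * sqrt (real n))"
      by simp
    also have "exp (real n * (A p - \<eta>) + \<bar>t\<bar> * K * sqrt (real n)) =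
       exp (2 * (\<bar>t\<bar> * K) * sqrt (real n) - real n * \<eta> / 2) * exp (real n * (A p - \<eta> / 2) - \<bar>t\<bar> * K * sqrt (real n))"
      by (simp add: algebra_simps flip: exp_add)
    also have "\<dots> \<le> exp (B * sqrt (real n) - real n * \<eta> / 2) * (exp 2 * (real n)\<^sup>2 * Zr n t)"
      by (intro mult_mono Z) (auto simp: B_def algebra_simps)
    finally have "(\<Sum>k\<le>n. awt n t k * far n \<delta> k) \<le> (real n + 1) * (exp (B * sqrt (real n) - real n * \<eta> / 2) * (exp 2 * (real n)\<^sup>2 * Zr n t))"
      by simp
    hence "real n * (\<Sum>k\<le>n. awt n t k * far n \<delta> k) \<le> real n * ((real n + 1) * (exp (B * sqrt (real n) - real n * \<eta> / 2) * (exp 2 * (real n)\<^sup>2 * Zr n t)))"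
      by (intro mult_left_mono) simp_all
    thus ?case using Zr_pos[of n t] by (simp add: r_def field_simps)
  qed
  have "r \<longlonglongrightarrow> 0" unfolding r_def using B \<eta>(1) by real_asymp
  hence "(\<lambda>n. real n * (\<Sum>k\<le>n. awt n t k * far n \<delta> k) / Zr n t) \<longlonglongrightarrow> 0"
    by (intro tendsto_sandwich[OF _ ev tendsto_const])
       (auto intro!: always_eventually divide_nonneg_pos Zr_pos mult_nonneg_nonneg sum_nonneg)
  \<comment> \<open>Convergence implies boundedness, so the eventual estimate turns into one
    constant for every n.\<close>
  hence "Bseq (\<lambda>n. real n * (\<Sum>k\<le>n. awt n t k * far n \<delta> k) / Zr n t)"
    by (intro convergent_imp_Bseq) (auto simp: convergent_def)
  then obtain C where C: "C > 0" "\<And>n. norm (real n * (\<Sum>k\<le>n. awt n t k * far n \<delta> k) / Zr n t) \<le> C"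
    by (auto elim: BseqE)
  have "(\<Sum>k\<le>n. awt n t k * far n \<delta> k) \<le> C / real n * Zr n t" if "n \<ge> 1" for n
  proof -
    have "real n * (\<Sum>k\<le>n. awt n t k * far n \<delta> k) / Zr n t \<le> C"
      by (rule order.trans[OF abs_ge_self C(2)[of n, unfolded real_norm_def]])
    thus ?thesis using Zr_pos[of n t] that by (simp add: field_simps)
  qed
  with C(1) show ?thesis by (intro that[of C]) auto
qed


text \<open>
  \<open>Q n z k\<close> is the factor of detailed balance: the ratio of the weights of \<open>k + 1\<close> and \<open>k\<close>, times
  \<open>(k + 1) / n\<close>.
\<close>

definition Q :: "nat \<Rightarrow> complex \<Rightarrow> nat \<Rightarrow> complex" where
  "Q n z k = of_real (1 - real k / real n) *
     exp (of_real (real n * (f (real (Suc k) / real n) - f (real k / real n)))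
       + z * of_real (sqrt (real n) * (\<phi> (real (Suc k) / real n) - \<phi> (real k / real n))))"

lemma wt_Suc:
  assumes "k < n"
  shows "wt n z (Suc k) * of_real (real (Suc k) / real n) = wt n z k * Q n z k"
proof -
  have "Suc k * (n choose Suc k) = (n - k) * (n choose k)"
    using binomial_absorb_comp[of n k] binomial_absorption[of k n] by simp
  hence "of_nat (Suc k * (n choose Suc k)) = (of_nat ((n - k) * (n choose k)) :: complex)"
    by (simp only:)
  moreover have "of_nat n - of_nat k = (of_nat (n - k) :: complex)"
    using assms by (simp add: of_nat_diff)
  ultimately have b: "of_nat (n choose Suc k) * of_nat (Suc k) = (of_nat (n choose k) * (of_nat n - of_nat k) :: complex)"
    by (simp only: of_nat_mult mult.commute)
  have e: "exp (of_real (real n * f (real (Suc k) / real n)) + z * of_real (sqrt (real n) * \<phi> (real (Suc k) / real n)))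
    = exp (of_real (real n * f (real k / real n)) + z * of_real (sqrt (real n) * \<phi> (real k / real n))) *
     exp (of_real (real n * (f (real (Suc k) / real n) - f (real k / real n)))
       + z * of_real (sqrt (real n) * (\<phi> (real (Suc k) / real n) - \<phi> (real k / real n))))"
    unfolding exp_add[symmetric] by (rule arg_cong[of _ _ exp]) (simp add: algebra_simps del: of_nat_Suc)
  have "wt n z (Suc k) * of_real (real (Suc k) / real n) =
     (of_nat (n choose Suc k) * of_nat (Suc k)) / of_nat n *
      exp (of_real (real n * f (real (Suc k) / real n)) + z * of_real (sqrt (real n) * \<phi> (real (Suc k) / real n)))"
    by (simp add: wt_def del: of_nat_Suc)
  also have "\<dots> = wt n z k * Q n z k"
    unfolding b e wt_def Q_def using assms by (simp add: field_simps del: of_nat_Suc)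
  finally show ?thesis .
qed

lemma Q_self: "n > 0 \<Longrightarrow> Q n z n = 0"
  by (simp add: Q_def)

text \<open>Summation by parts: the second sum is shifted by one and rewritten by detailed balance.
  The boundary terms drop out because k/n vanishes at 0 and \<open>Q\<close> vanishes at n. No
  regularity of \<open>G\<close> enters, so the discontinuous \<open>right\<close> is
  admissible.\<close>

lemma stein_identity:
  assumes "n > 0"
  shows "(\<Sum>k\<le>n. wt n z k * (Q n z k * of_real (G (real (Suc k) / real n))
            - of_real (real k / real n * G (real k / real n)))) = 0"
proof -
  have "(\<Sum>k\<le>n. wt n z k * of_real (real k / real n * G (real k / real n)))
      = (\<Sum>k<n. wt n z (Suc k) * of_real (real (Suc k) / real n * G (real (Suc k) / real n)))"
    by (subst sum.atMost_shift) simp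
  also have "\<dots> = (\<Sum>k<n. wt n z k * (Q n z k * of_real (G (real (Suc k) / real n))))"
  proof (rule sum.cong)
    fix k assume "k \<in> {..<n}"
    thus "wt n z (Suc k) * of_real (real (Suc k) / real n * G (real (Suc k) / real n))
        = wt n z k * (Q n z k * of_real (G (real (Suc k) / real n)))"
      using wt_Suc[of k n z] by (simp only: of_real_mult flip: mult.assoc) simp
  qed simp
  also have "\<dots> = (\<Sum>k\<le>n. wt n z k * (Q n z k * of_real (G (real (Suc k) / real n))))"
    using Q_self[OF assms] by (simp flip: lessThan_Suc_atMost)
  finally show ?thesis by (simp add: right_diff_distrib sum_subtractf)
qed

section \<open>First-order expansion of the detailed balance factor at the right-hand well\<close>

lemma mult_inverse_sqrt_le:
  assumes "n \<ge> 1"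
  shows "\<bar>x\<bar> / sqrt (real n) \<le> 1 / real n + x\<^sup>2"
proof -
  have "2 * (\<bar>x\<bar> * (1 / sqrt (real n))) \<le> \<bar>x\<bar>\<^sup>2 + (1 / sqrt (real n))\<^sup>2"
    using sum_squares_bound[of "\<bar>x\<bar>" "1 / sqrt (real n)"] by simp
  moreover have "0 \<le> \<bar>x\<bar> * (1 / sqrt (real n))" by simp
  ultimately have "\<bar>x\<bar> * (1 / sqrt (real n)) \<le> \<bar>x\<bar>\<^sup>2 + (1 / sqrt (real n))\<^sup>2" by linarith
  thus ?thesis by (simp add: power_divide)
qed

text \<open>Two approximations are chained. Difference quotients are replaced by derivatives at a =
  k/n, which costs O(1/n); then the coefficients are linearized or frozen at \<open>p\<close>, using
  \<open>drift\<close> and the Lipschitz bound for \<open>\<phi>1\<close>. The estimate is global in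
  k, since the quadratic error is allowed to be of order one far from \<open>p\<close>.\<close>

lemma Q_expansion:
  assumes "R \<ge> 0"
  obtains C where "C \<ge> 0" "\<And>n k z. n \<ge> 1 \<Longrightarrow> k \<le> n \<Longrightarrow> norm z \<le> R \<Longrightarrow>
     norm (Q n z k - (of_real (real k / real n + \<kappa> * (real k / real n - p)) + z * of_real (p * \<phi>1 p / sqrt (real n))))
       \<le> C * (1 / real n + (real k / real n - p)\<^sup>2)"
proof -
  \<comment> \<open>\<open>B / sqrt n\<close> will bound the small part \<open>\<zeta>\<close> of
    the exponent, \<open>C1 / n\<close> the error of linearizing its exponential, and
    \<open>C2 * \<bar>x\<bar>\<close> the change of the tilt coefficient between a and
    \<open>p\<close>.\<close>
  define B where "B = K + R * K + R * K"
  define C1 where "C1 = exp B * B\<^sup>2 + (K + R * K)"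
  define C2 where "C2 = exp K * K + (1 + \<bar>\<kappa>\<bar> + K) * K"
  define C where "C = exp K * C1 + K + R * C2"
  have nn: "B \<ge> 0" "C1 \<ge> 0" "C2 \<ge> 0" "C \<ge> 0"
    using K_nonneg assms by (auto simp: B_def C1_def C2_def C_def)
  show ?thesis
  proof (rule that[OF nn(4)])
    fix n k :: nat and z :: complex
    assume n: "n \<ge> 1" and k: "k \<le> n" and z: "norm z \<le> R"
    define a where "a = real k / real n"
    define x where "x = a - p"
    define q where "q = (1 - a) * exp (f1 a)"
    have a: "a \<in> {0..1}" using frac_mem[OF k] by (simp add: a_def)
    have q: "0 \<le> q" "q \<le> exp K"
    proof -
      show "0 \<le> q" using a by (simp add: q_def)
      have "q \<le> 1 * exp K"
        unfolding q_def using a f1_bound[OF a] by (intro mult_mono) auto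
      thus "q \<le> exp K" by simp
    qed
    have n1: "1 / real n \<le> 1 / sqrt (real n)" "1 / sqrt (real n) \<le> 1" "1 / real n \<le> 1"
    proof -
      have "1 \<le> real n" using n by simp
      hence s: "sqrt (real n) \<le> real n" "1 \<le> sqrt (real n)"
        by (auto intro: real_le_lsqrt simp: power2_eq_square)
      thus "1 / real n \<le> 1 / sqrt (real n)" "1 / sqrt (real n) \<le> 1" "1 / real n \<le> 1"
        using n by (auto simp: field_simps)
    qed
    have Q: "norm (Q n z k - of_real q * (1 + z * of_real (\<phi>1 a / sqrt (real n)))) \<le> exp K * C1 / real n"
    proof (cases "k = n")
      case True
      hence "q = 0" using n by (simp add: q_def a_def)
      thus ?thesis using n nn True by (simp add: Q_self)
    next
      case False
      define a' where "a' = real (Suc k) / real n"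
      have a': "a' \<in> {0..1}" using frac_mem[of "Suc k" n] False k by (simp add: a'_def)
      have d: "a' - a = 1 / real n" using n by (simp add: a_def a'_def field_simps)
      define w1 where "w1 = real n * (f a' - f a) - f1 a"
      define w2 where "w2 = sqrt (real n) * (\<phi> a' - \<phi> a) - \<phi>1 a / sqrt (real n)"
      have "w1 = real n * (f a' - f a - (a' - a) * f1 a)"
        unfolding d using n by (simp add: w1_def algebra_simps)
      hence "\<bar>w1\<bar> = real n * \<bar>f a' - f a - (a' - a) * f1 a\<bar>" by (simp add: abs_mult)
      also have "\<dots> \<le> real n * (K * (a' - a)\<^sup>2)"
        by (intro mult_left_mono f_taylor a a') simp
      also have "\<dots> = K / real n" unfolding d using n by (simp add: power2_eq_square)
      finally have w1: "\<bar>w1\<bar> \<le> K / real n" .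
      have "w2 = sqrt (real n) * (\<phi> a' - \<phi> a - (a' - a) * \<phi>1 a)"
        unfolding d using n by (simp add: w2_def algebra_simps real_div_sqrt divide_simps)
      hence "\<bar>w2\<bar> = sqrt (real n) * \<bar>\<phi> a' - \<phi> a - (a' - a) * \<phi>1 a\<bar>" by (simp add: abs_mult)
      also have "\<dots> \<le> sqrt (real n) * (K * (a' - a)\<^sup>2)"
        by (intro mult_left_mono phi_taylor a a') simp
      also have "\<dots> = K / real n * (1 / sqrt (real n))" unfolding d using n
        by (simp add: power2_eq_square field_simps)
      also have "\<dots> \<le> K / real n * 1"
        using n1 K_nonneg by (intro mult_left_mono) auto
      finally have w2: "\<bar>w2\<bar> \<le> K / real n" by simp
      \<comment> \<open>This is the exponent in \<open>Q\<close> without its main part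
        \<open>f1 a\<close>. The Taylor remainders \<open>w1\<close> and \<open>w2\<close> are
        O(1/n), and the tilt is O(1/sqrt n), so its square is again O(1/n).\<close>
      define \<zeta> where "\<zeta> = of_real w1 + z * of_real w2 + z * of_real (\<phi>1 a / sqrt (real n))"
      have w12: "norm (of_real w1 + z * of_real w2) \<le> (K + R * K) / real n"
      proof -
        have "norm (of_real w1 + z * of_real w2) \<le> \<bar>w1\<bar> + norm z * \<bar>w2\<bar>"
          by (rule order.trans[OF norm_triangle_ineq]) (simp add: norm_mult)
        also have "\<dots> \<le> K / real n + R * (K / real n)"
          using w1 w2 z assms by (intro add_mono mult_mono) auto
        finally show ?thesis by (simp add: add_divide_distrib)
      qed
      have "norm (z * of_real (\<phi>1 a / sqrt (real n))) = norm z * \<bar>\<phi>1 a\<bar> / sqrt (real n)"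
        by (simp add: norm_mult norm_divide)
      also have "\<dots> \<le> R * K / sqrt (real n)"
        using z phi1_bound[OF a] assms by (intro divide_right_mono mult_mono) auto
      finally have w3: "norm (z * of_real (\<phi>1 a / sqrt (real n))) \<le> R * K / sqrt (real n)" .
      have "(K + R * K) / real n \<le> (K + R * K) / sqrt (real n)"
        using mult_left_mono[OF n1(1), of "K + R * K"] K_nonneg assms by simp
      hence "norm \<zeta> \<le> (K + R * K) / sqrt (real n) + R * K / sqrt (real n)"
        unfolding \<zeta>_def using w12 w3 by (intro order.trans[OF norm_triangle_ineq]) linarith
      hence zB: "norm \<zeta> \<le> B / sqrt (real n)" by (simp add: B_def add_divide_distrib)
      also have "\<dots> \<le> B" using mult_left_mono[OF n1(2), of B] nn by simp
      finally have zB': "norm \<zeta> \<le> B" .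
      have "norm (exp \<zeta> - 1 - \<zeta>) \<le> exp \<bar>Re \<zeta>\<bar> * norm \<zeta> ^ 2"
        using Taylor_exp[of \<zeta> 1] by (simp add: numeral_2_eq_2 diff_diff_eq)
      also have "\<dots> \<le> exp B * (B / sqrt (real n)) ^ 2"
        using zB zB' abs_Re_le_cmod[of \<zeta>] by (intro mult_mono power_mono) auto
      also have "\<dots> = exp B * B\<^sup>2 / real n" by (simp add: power_divide)
      finally have "norm (exp \<zeta> - 1 - \<zeta>) \<le> exp B * B\<^sup>2 / real n" .
      moreover have "exp \<zeta> - (1 + z * of_real (\<phi>1 a / sqrt (real n))) = (exp \<zeta> - 1 - \<zeta>) + (of_real w1 + z * of_real w2)"
        by (simp add: \<zeta>_def)
      hence "norm (exp \<zeta> - (1 + z * of_real (\<phi>1 a / sqrt (real n)))) \<le> norm (exp \<zeta> - 1 - \<zeta>) + norm (of_real w1 + z * of_real w2)"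
        by (simp only: norm_triangle_ineq)
      ultimately have E: "norm (exp \<zeta> - (1 + z * of_real (\<phi>1 a / sqrt (real n)))) \<le> C1 / real n"
        using w12 unfolding C1_def add_divide_distrib[of "exp B * B\<^sup>2"] by linarith
      have "of_real (real n * (f a' - f a)) + z * of_real (sqrt (real n) * (\<phi> a' - \<phi> a)) = of_real (f1 a) + \<zeta>"
        unfolding \<zeta>_def w1_def w2_def by (simp add: algebra_simps)
      hence "Q n z k = of_real q * exp \<zeta>"
        unfolding Q_def a_def[symmetric] a'_def[symmetric] q_def by (simp add: exp_add exp_of_real)
      hence "Q n z k - of_real q * (1 + z * of_real (\<phi>1 a / sqrt (real n)))
           = of_real q * (exp \<zeta> - (1 + z * of_real (\<phi>1 a / sqrt (real n))))"
        by (simp add: right_diff_distrib)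
      hence "norm (Q n z k - of_real q * (1 + z * of_real (\<phi>1 a / sqrt (real n))))
           = q * norm (exp \<zeta> - (1 + z * of_real (\<phi>1 a / sqrt (real n))))"
        using q by (simp add: norm_mult)
      also have "\<dots> \<le> exp K * (C1 / real n)"
        using q E nn by (intro mult_mono) auto
      finally show ?thesis by simp
    qed
    have x1: "\<bar>x\<bar> \<le> 1" using a p by (auto simp: x_def)
    have D: "\<bar>q - (a + \<kappa> * x)\<bar> \<le> K * x\<^sup>2"
      using drift[OF a] by (simp add: q_def x_def algebra_simps)
    have "x\<^sup>2 \<le> \<bar>x\<bar>" using power_decreasing[of 1 2 "\<bar>x\<bar>"] x1 by simp
    hence "K * x\<^sup>2 \<le> K * \<bar>x\<bar>" using K_nonneg by (rule mult_left_mono)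
    moreover have "q - p = (q - (a + \<kappa> * x)) + x + \<kappa> * x" by (simp add: x_def)
    moreover have "\<bar>\<kappa> * x\<bar> = \<bar>\<kappa>\<bar> * \<bar>x\<bar>" by (simp add: abs_mult)
    ultimately have "\<bar>q - p\<bar> \<le> (1 + \<bar>\<kappa>\<bar> + K) * \<bar>x\<bar>" using D unfolding distrib_right by linarith
    hence "\<bar>q - p\<bar> * \<bar>\<phi>1 p\<bar> \<le> (1 + \<bar>\<kappa>\<bar> + K) * \<bar>x\<bar> * K"
      using phi1_bound[of p] p K_nonneg by (intro mult_mono) auto
    moreover have "q * \<bar>\<phi>1 a - \<phi>1 p\<bar> \<le> exp K * (K * \<bar>x\<bar>)"
      using phi1_lipschitz[OF a] q K_nonneg by (intro mult_mono) (auto simp: x_def)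
    moreover have "q * \<phi>1 a - p * \<phi>1 p = q * (\<phi>1 a - \<phi>1 p) + (q - p) * \<phi>1 p" by (simp add: algebra_simps)
    hence "\<bar>q * \<phi>1 a - p * \<phi>1 p\<bar> \<le> q * \<bar>\<phi>1 a - \<phi>1 p\<bar> + \<bar>q - p\<bar> * \<bar>\<phi>1 p\<bar>"
      using q abs_triangle_ineq[of "q * (\<phi>1 a - \<phi>1 p)" "(q - p) * \<phi>1 p"] by (simp add: abs_mult)
    ultimately have P: "\<bar>q * \<phi>1 a - p * \<phi>1 p\<bar> \<le> C2 * \<bar>x\<bar>"
      unfolding C2_def by (simp add: algebra_simps)
    have "norm (z * of_real ((q * \<phi>1 a - p * \<phi>1 p) / sqrt (real n))) \<le> R * ((C2 * \<bar>x\<bar>) / sqrt (real n))"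
      unfolding norm_mult norm_of_real abs_divide using z P assms
      by (intro mult_mono) (auto intro!: divide_right_mono)
    also have "\<dots> = R * C2 * (\<bar>x\<bar> / sqrt (real n))" by simp
    \<comment> \<open>The mixed error \<open>\<bar>x\<bar> / sqrt n\<close> is split by the
      inequality of arithmetic and geometric means, so that only the two standard error types
      remain.\<close>
    also have "\<dots> \<le> R * C2 * (1 / real n + x\<^sup>2)"
      using nn assms by (intro mult_left_mono mult_inverse_sqrt_le n) auto
    finally have Pz: "norm (z * of_real ((q * \<phi>1 a - p * \<phi>1 p) / sqrt (real n))) \<le> R * C2 * (1 / real n + x\<^sup>2)" .
    have "Q n z k - (of_real (a + \<kappa> * x) + z * of_real (p * \<phi>1 p / sqrt (real n)))
       = (Q n z k - of_real q * (1 + z * of_real (\<phi>1 a / sqrt (real n)))) + of_real (q - (a + \<kappa> * x))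
         + z * of_real ((q * \<phi>1 a - p * \<phi>1 p) / sqrt (real n))"
      by (simp add: algebra_simps diff_divide_distrib)
    also have "norm \<dots> \<le> exp K * C1 / real n + K * x\<^sup>2 + R * C2 * (1 / real n + x\<^sup>2)"
      by (intro order.trans[OF norm_triangle_ineq] add_mono)
        (use Q D Pz in \<open>auto simp del: of_real_diff of_real_add of_real_mult of_real_divide\<close>)
    also have "\<dots> \<le> C * (1 / real n + x\<^sup>2)"
    proof -
      have "0 \<le> exp K * C1 * x\<^sup>2 + K * (1 / real n)" using nn K_nonneg by simp
      thus ?thesis unfolding C_def by (simp add: algebra_simps)
    qed
    finally show "norm (Q n z k - (of_real (real k / real n + \<kappa> * (real k / real n - p)) + z * of_real (p * \<phi>1 p / sqrt (real n))))
       \<le> C * (1 / real n + (real k / real n - p)\<^sup>2)"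
      by (simp add: a_def x_def)
  qed
qed

end

section \<open>Second moment in the right-hand well\<close>

lemma young_mult:
  fixes b c l :: real
  assumes "l > 0"
  shows "b * c \<le> l * c\<^sup>2 + b\<^sup>2 / (4 * l)"
proof -
  have "0 \<le> (2 * l * c - b)\<^sup>2" by simp
  hence "b * c * (4 * l) \<le> (l * c\<^sup>2) * (4 * l) + b\<^sup>2"
    by (simp add: power2_diff power_mult_distrib) (simp add: power2_eq_square ac_simps)
  thus ?thesis using assms by (simp add: field_simps)
qed

context double_well begin

lemma far_right:
  assumes "real k / real n > 1 / 2" "\<bar>real k / real n - p\<bar> \<ge> \<delta>" "\<delta> \<le> (p - 1 / 2) / 2"
  shows "far n \<delta> k = 1"
proof -
  have "\<delta> \<le> real k / real n - (1 - p)" using assms p by argo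
  hence "\<delta> \<le> \<bar>real k / real n - (1 - p)\<bar>" by linarith
  thus ?thesis using assms by (simp add: far_def)
qed

lemma right_Suc: "real k / real n > 1 / 2 \<Longrightarrow> right (real (Suc k) / real n) = 1"
  unfolding right_def using divide_right_mono[of "real k" "real (Suc k)" "real n"]
  by (simp del: of_nat_Suc)

text \<open>A grid point left of 1/2 that is not far lies near \<open>1 - p\<close>, so a step
  across 1/2 has to cover a fixed distance; this forces n to be at most
  \<open>2 / (p - 1 / 2)\<close> times a constant-free bound of 1, which the second term accounts
  for. For larger n every crossing point is far.\<close>

lemma crossing_le:
  assumes "n \<ge> 1" "real k / real n \<le> 1 / 2" "real (Suc k) / real n > 1 / 2" "\<delta> \<le> (p - 1 / 2) / 2"
  shows "1 \<le> far n \<delta> k + 2 / (p - 1 / 2) / real n"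
proof (cases "far n \<delta> k = 1")
  case False
  moreover have "\<delta> \<le> p - real k / real n" using assms p by argo
  hence "\<delta> \<le> \<bar>real k / real n - p\<bar>" by linarith
  ultimately have "\<bar>real k / real n - (1 - p)\<bar> < \<delta>"
    by (auto simp: far_def split: if_splits)
  moreover have "real (Suc k) / real n = real k / real n + 1 / real n" by (simp add: add_divide_distrib)
  ultimately have "1 / real n \<ge> (p - 1 / 2) / 2" using assms by argo
  hence "2 / (p - 1 / 2) * ((p - 1 / 2) / 2) \<le> 2 / (p - 1 / 2) * (1 / real n)"
    using p by (intro mult_left_mono) auto
  moreover have "2 / (p - 1 / 2) * ((p - 1 / 2) / 2) = 1" using p by simp
  ultimately have "1 \<le> 2 / (p - 1 / 2) * (1 / real n)" by (simp only:)
  also have "\<dots> = 2 / (p - 1 / 2) / real n" by simp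
  finally show ?thesis using far_nonneg[of n \<delta> k] by linarith
qed (use p in simp)

text \<open>
  Stein's identity for the test function \<open>right a * (a - p)\<close>: near \<open>p\<close> the drift pulls back with
  strength \<open>- \<kappa>\<close>, and everything else is of order \<open>1 / n\<close>.
\<close>

lemma second_moment_le:
  obtains C where "C \<ge> 0" "\<And>n. n \<ge> 1 \<Longrightarrow> (\<Sum>k\<le>n. awt n t k * (right (real k / real n) * (real k / real n - p)\<^sup>2)) \<le> C / real n * Zr n t"
proof -
  obtain C where C: "C \<ge> 0" and CQ: "\<And>n k z. n \<ge> 1 \<Longrightarrow> k \<le> n \<Longrightarrow> norm z \<le> \<bar>t\<bar> \<Longrightarrow>
     norm (Q n z k - (of_real (real k / real n + \<kappa> * (real k / real n - p)) + z * of_real (p * \<phi>1 p / sqrt (real n))))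
       \<le> C * (1 / real n + (real k / real n - p)\<^sup>2)"
    by (rule Q_expansion[of "\<bar>t\<bar>"]) auto
  \<comment> \<open>The first bound separates the wells from the midpoint. The second lets a quarter
    of the drift absorb the cubic term \<open>C * \<bar>x\<bar> ^ 3\<close> within distance
    \<open>\<delta>\<close> of \<open>p\<close>; the denominator uses \<open>C + 1\<close> because
    \<open>C\<close> may be 0.\<close>
  define \<delta> where "\<delta> = min ((p - 1 / 2) / 2) (- \<kappa> / (4 * (C + 1)))"
  have \<delta>: "\<delta> > 0" "\<delta> \<le> (p - 1 / 2) / 2" "C * \<delta> \<le> - \<kappa> / 4"
  proof -
    show "\<delta> \<le> (p - 1 / 2) / 2" unfolding \<delta>_def by (rule min.cobounded1)
    show "\<delta> > 0" using p \<kappa> C by (auto simp: \<delta>_def intro!: divide_neg_pos)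
    hence "C * \<delta> \<le> (C + 1) * \<delta>" by simp
    also have "\<dots> \<le> (C + 1) * (- \<kappa> / (4 * (C + 1)))"
      using C by (intro mult_left_mono) (auto simp: \<delta>_def)
    also have "\<dots> = - \<kappa> / 4" using C by (simp add: field_simps)
    finally show "C * \<delta> \<le> - \<kappa> / 4" .
  qed
  obtain Cf where Cf: "Cf \<ge> 0" "\<And>n. n \<ge> 1 \<Longrightarrow> (\<Sum>k\<le>n. awt n t k * far n \<delta> k) \<le> Cf / real n * Zr n t"
    by (rule far_sum_le[OF \<delta>(1), where t = t]) auto
  define L where "L = \<bar>t * (p * \<phi>1 p)\<bar>"
  define C3 where "C3 = L + C"
  define C0 where "C0 = 1 + \<bar>\<kappa>\<bar> + L + 2 * C"
  define n0 where "n0 = 2 / (p - 1 / 2)"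
  define D3 where "D3 = C3\<^sup>2 / (- \<kappa>)"
  define M1 where "M1 = C0 + D3 + C0 * n0"
  define M2 where "M2 = C + C0"
  have "D3 \<ge> 0" unfolding D3_def using \<kappa> by (intro divide_nonneg_pos) auto
  hence nn: "L \<ge> 0" "C3 \<ge> 0" "C0 \<ge> 0" "n0 \<ge> 0" "D3 \<ge> 0" "M2 \<ge> 0" "M1 \<ge> 0"
    using C p \<kappa> by (auto simp: L_def C3_def C0_def n0_def M2_def M1_def intro!: add_nonneg_nonneg mult_nonneg_nonneg)
  define N where "N = M1 + M2 * Cf"
  have bound: "(\<Sum>k\<le>n. awt n t k * (right (real k / real n) * (real k / real n - p)\<^sup>2)) \<le> (2 / (- \<kappa>) * N) / real n * Zr n t"
    if n: "n \<ge> 1" for n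
  proof -
    define T where "T = (\<lambda>k. Re (Q n (of_real t) k) * (right (real (Suc k) / real n) * (real (Suc k) / real n - p))
        - real k / real n * (right (real k / real n) * (real k / real n - p)))"
    have "Re (\<Sum>k\<le>n. wt n (of_real t) k * (Q n (of_real t) k * of_real (right (real (Suc k) / real n) * (real (Suc k) / real n - p))
            - of_real (real k / real n * (right (real k / real n) * (real k / real n - p))))) = 0"
      using stein_identity[of n "of_real t" "\<lambda>a. right a * (a - p)"] n by simp
    hence T0: "(\<Sum>k\<le>n. awt n t k * T k) = 0"
      unfolding T_def wt_of_real Re_sum by (simp del: of_real_mult of_nat_Suc of_real_diff)
    have sq: "sqrt (real n) > 0" "1 / real n \<le> 1 / sqrt (real n)" "1 / sqrt (real n) \<le> 1" "1 / real n \<le> 1"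
    proof -
      have "1 \<le> real n" using n by simp
      hence s: "sqrt (real n) \<le> real n" "1 \<le> sqrt (real n)"
        by (auto intro: real_le_lsqrt simp: power2_eq_square)
      thus "sqrt (real n) > 0" "1 / real n \<le> 1 / sqrt (real n)" "1 / sqrt (real n) \<le> 1" "1 / real n \<le> 1"
        using n by (auto simp: field_simps)
    qed
    \<comment> \<open>Each Stein summand is bounded by half of the negative quadratic drift plus
      harmless terms. The cases are: k right of 1/2, the step across 1/2, and both points on the
      left, where the test function vanishes.\<close>
    have Tk: "T k \<le> \<kappa> / 2 * (right (real k / real n) * (real k / real n - p)\<^sup>2) + M1 / real n + M2 * far n \<delta> k"
      if k: "k \<le> n" for k
    proof -
      define a where "a = real k / real n"
      define x where "x = a - p"
      define q where "q = Re (Q n (of_real t) k)"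
      have a: "a \<in> {0..1}" using frac_mem[OF k] by (simp add: a_def)
      have x1: "\<bar>x\<bar> \<le> 1" using a p by (auto simp: x_def)
      hence x2: "x\<^sup>2 \<le> 1" by (simp add: abs_square_le_1)
      have a': "real (Suc k) / real n = a + 1 / real n" by (simp add: a_def add_divide_distrib)
      have "\<bar>q - (a + \<kappa> * x + t * (p * \<phi>1 p / sqrt (real n)))\<bar> \<le> C * (1 / real n + x\<^sup>2)"
        using order.trans[OF abs_Re_le_cmod CQ[OF n k, of "of_real t"]] by (simp add: q_def a_def x_def)
      moreover have "\<bar>t * (p * \<phi>1 p / sqrt (real n))\<bar> = L / sqrt (real n)"
        using sq by (simp add: L_def abs_mult)
      moreover have "\<bar>q - (a + \<kappa> * x)\<bar> \<le> \<bar>q - (a + \<kappa> * x + t * (p * \<phi>1 p / sqrt (real n)))\<bar> + \<bar>t * (p * \<phi>1 p / sqrt (real n))\<bar>"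
        using abs_triangle_ineq[of "q - (a + \<kappa> * x) - t * (p * \<phi>1 p / sqrt (real n))" "t * (p * \<phi>1 p / sqrt (real n))"]
        unfolding diff_add_cancel by (simp only: diff_diff_eq)
      ultimately have "\<bar>q - (a + \<kappa> * x)\<bar> \<le> C * (1 / real n + x\<^sup>2) + L / sqrt (real n)"
        by (elim order.trans) (simp only: add_mono order.refl)
      hence q: "\<bar>q - (a + \<kappa> * x)\<bar> \<le> L / sqrt (real n) + C * (1 / real n + x\<^sup>2)"
        by (simp only: add.commute)
      have "C / real n \<le> C / sqrt (real n)" using mult_left_mono[OF sq(2) C] by simp
      hence q1: "\<bar>q - (a + \<kappa> * x)\<bar> \<le> C3 / sqrt (real n) + C * x\<^sup>2"
        using q by (simp add: C3_def add_divide_distrib distrib_left)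
      have "L / sqrt (real n) \<le> L" using mult_left_mono[OF sq(3) nn(1)] by simp
      moreover have "C * (1 / real n + x\<^sup>2) \<le> C * 2" using add_mono[OF sq(4) x2] C by (intro mult_left_mono) (simp_all only: one_add_one)
      moreover have "\<bar>\<kappa> * x\<bar> \<le> \<bar>\<kappa>\<bar>" using mult_left_mono[OF x1, of "\<bar>\<kappa>\<bar>"] by (simp add: abs_mult)
      ultimately have q0: "\<bar>q\<bar> \<le> C0" using q a unfolding C0_def by auto
      show ?thesis
      proof (cases "a > 1 / 2")
        case True
        hence r: "right (real k / real n) = 1" "right (real (Suc k) / real n) = 1"
          using right_Suc[of k n] by (auto simp: right_def a_def)
        \<comment> \<open>The term \<open>q / real n\<close> arises because the test function is
          evaluated at (k + 1)/n rather than k/n.\<close>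
        have "T k = (q - (a + \<kappa> * x)) * x + \<kappa> * x\<^sup>2 + q / real n"
          unfolding T_def r unfolding a' q_def[symmetric] a_def[symmetric]
          by (simp add: x_def algebra_simps power2_eq_square)
        also have "(q - (a + \<kappa> * x)) * x \<le> (C3 / sqrt (real n) + C * x\<^sup>2) * \<bar>x\<bar>"
          using mult_right_mono[OF q1 abs_ge_zero[of x]] abs_ge_self[of "(q - (a + \<kappa> * x)) * x"] by (simp add: abs_mult)
        also have "\<dots> = C3 / sqrt (real n) * \<bar>x\<bar> + C * x\<^sup>2 * \<bar>x\<bar>" by (simp add: distrib_right)
        \<comment> \<open>A quarter of the drift pays for the linear term, and another quarter will
          pay for the cubic one; half of the drift survives.\<close>
        also have "C3 / sqrt (real n) * \<bar>x\<bar> \<le> (- \<kappa> / 4) * \<bar>x\<bar>\<^sup>2 + (C3 / sqrt (real n))\<^sup>2 / (4 * (- \<kappa> / 4))"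
          by (rule young_mult) (use \<kappa> in simp)
        also have "(C3 / sqrt (real n))\<^sup>2 / (4 * (- \<kappa> / 4)) = D3 / real n"
          by (simp add: power_divide D3_def)
        also have "q / real n \<le> C0 / real n" using q0 by (intro divide_right_mono) auto
        finally have "T k \<le> 3 * \<kappa> / 4 * x\<^sup>2 + C * x\<^sup>2 * \<bar>x\<bar> + (C0 + D3) / real n"
          unfolding add_divide_distrib by simp
        also have "(C0 + D3) / real n \<le> M1 / real n"
          unfolding M1_def using nn by (intro divide_right_mono) auto
        finally have T: "T k \<le> 3 * \<kappa> / 4 * x\<^sup>2 + C * x\<^sup>2 * \<bar>x\<bar> + M1 / real n" by simp
        have "C * x\<^sup>2 * \<bar>x\<bar> \<le> - \<kappa> / 4 * x\<^sup>2 + M2 * far n \<delta> k"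
        proof (cases "\<bar>x\<bar> < \<delta>")
          case True
          have "C * x\<^sup>2 * \<bar>x\<bar> \<le> C * x\<^sup>2 * \<delta>" using True C by (intro mult_left_mono) auto
          also have "\<dots> = C * \<delta> * x\<^sup>2" by simp
          also have "\<dots> \<le> - \<kappa> / 4 * x\<^sup>2" by (intro mult_right_mono \<delta>) auto
          finally show ?thesis using mult_nonneg_nonneg[OF nn(6) far_nonneg[of n \<delta> k]] by linarith
        next
          case False
          hence "far n \<delta> k = 1" using True \<delta> by (intro far_right) (auto simp: a_def x_def)
          moreover have "C * x\<^sup>2 * \<bar>x\<bar> \<le> C * 1 * 1" using C x1 x2 by (intro mult_mono) auto
          moreover have "- \<kappa> / 4 * x\<^sup>2 \<ge> 0" using \<kappa> by (intro mult_nonneg_nonneg) auto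
          ultimately show ?thesis using nn by (simp add: M2_def)
        qed
        thus ?thesis using T unfolding r by (simp add: x_def a_def)
      next
        case False
        hence r: "right (real k / real n) = 0" by (auto simp: right_def a_def)
        show ?thesis
        proof (cases "real (Suc k) / real n > 1 / 2")
          case True
          have "T k = q * (real (Suc k) / real n - p)"
            using True unfolding T_def r q_def by (simp add: right_def)
          also have "\<dots> \<le> \<bar>q\<bar> * \<bar>real (Suc k) / real n - p\<bar>" by (simp add: abs_mult[symmetric])
          also have "\<dots> \<le> C0 * 1"
          proof -
            have "0 \<le> 1 / real n" by simp
            hence "\<bar>a + 1 / real n - p\<bar> \<le> 1" using \<open>\<not> a > 1 / 2\<close> a p sq(4) unfolding atLeastAtMost_iff by linarith
            thus ?thesis unfolding a' using q0 nn by (intro mult_mono) auto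
          qed
          also have "\<dots> \<le> C0 * (far n \<delta> k + n0 / real n)"
            unfolding n0_def using n False True \<delta> nn by (intro mult_left_mono crossing_le) (auto simp: a_def)
          also have "\<dots> \<le> M2 * far n \<delta> k + M1 / real n"
          proof -
            have "C0 * far n \<delta> k \<le> M2 * far n \<delta> k" using C by (intro mult_right_mono) (auto simp: M2_def)
            moreover have "C0 * n0 / real n \<le> M1 / real n" using nn by (intro divide_right_mono) (auto simp: M1_def)
            ultimately show ?thesis by (simp add: distrib_left)
          qed
          finally show ?thesis unfolding r by simp
        next
          case False
          hence "T k = 0" unfolding T_def r by (simp add: right_def)
          thus ?thesis unfolding r using nn by simp
        qed
      qed
    qed
    define S where "S = (\<Sum>k\<le>n. awt n t k * (right (real k / real n) * (real k / real n - p)\<^sup>2))"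
    have "0 = (\<Sum>k\<le>n. awt n t k * T k)" using T0 by simp
    also have "\<dots> \<le> (\<Sum>k\<le>n. awt n t k * (\<kappa> / 2 * (right (real k / real n) * (real k / real n - p)\<^sup>2) + M1 / real n + M2 * far n \<delta> k))"
      using Tk by (intro sum_mono mult_left_mono) auto
    also have "\<dots> = \<kappa> / 2 * S + M1 / real n * Zr n t + M2 * (\<Sum>k\<le>n. awt n t k * far n \<delta> k)"
      unfolding S_def Zr_def by (simp add: distrib_left sum.distrib sum_distrib_left ac_simps)
    also have "\<dots> \<le> \<kappa> / 2 * S + M1 / real n * Zr n t + M2 * (Cf / real n * Zr n t)"
      using nn Cf(2)[OF n] by (intro add_left_mono mult_left_mono) auto
    \<comment> \<open>Since \<open>\<kappa>\<close> is negative, the drift moves to the left as a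
      positive multiple of the second moment.\<close>
    finally have "(- \<kappa>) / 2 * S \<le> N / real n * Zr n t"
      by (simp add: N_def algebra_simps add_divide_distrib)
    hence "2 / (- \<kappa>) * ((- \<kappa>) / 2 * S) \<le> 2 / (- \<kappa>) * (N / real n * Zr n t)"
      using \<kappa> by (intro mult_left_mono) auto
    thus ?thesis using \<kappa> by (simp add: S_def)
  qed
  show ?thesis
  proof (rule that[OF _ bound])
    show "0 \<le> 2 / (- \<kappa>) * N"
      unfolding N_def using nn Cf \<kappa> by (intro mult_nonneg_nonneg divide_nonneg_pos add_nonneg_nonneg) auto
  qed
qed


section \<open>Reflection and the linear relation for complex tilts\<close>

lemma norm_weighted_sum_le:
  assumes "Re z = t" "\<And>k. k \<le> n \<Longrightarrow> norm (c k) \<le> B k"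
  shows "norm (\<Sum>k\<le>n. wt n z k * c k) \<le> (\<Sum>k\<le>n. awt n t k * B k)"
  using assms by (intro sum_norm_le) (auto simp: norm_mult norm_wt intro!: mult_left_mono)

lemma wt_reflect:
  assumes "k \<le> n"
  shows "wt n z (n - k) = wt n z k"
proof (cases "n = 0")
  case False
  hence "real (n - k) / real n = 1 - real k / real n"
    using assms by (simp add: of_nat_diff diff_divide_distrib)
  thus ?thesis using binomial_symmetric[OF assms] by (simp add: wt_def f_sym phi_sym)
qed (use assms in simp)

text \<open>Reflection exchanges the two halves without changing weights or \<open>G\<close>, so
  only the midpoint is missed by twice the right half. The midpoint is far from both wells.\<close>

lemma symmetric_sum:
  assumes n: "n \<ge> 1" and \<delta>: "\<delta> \<le> (p - 1 / 2) / 2" and "Re z = t"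
    and sym: "\<And>a. G (1 - a) = G a" and B: "\<And>a. a \<in> {0..1} \<Longrightarrow> \<bar>G a\<bar> \<le> B"
  shows "norm ((\<Sum>k\<le>n. wt n z k * of_real (G (real k / real n)))
     - 2 * (\<Sum>k\<le>n. wt n z k * of_real (right (real k / real n) * G (real k / real n))))
     \<le> B * (\<Sum>k\<le>n. awt n t k * far n \<delta> k)"
proof -
  have refl: "real (n - k) / real n = 1 - real k / real n" if "k \<le> n" for k
    using that n by (simp add: of_nat_diff diff_divide_distrib)
  have "(\<Sum>k\<le>n. wt n z k * of_real (right (real k / real n) * G (real k / real n)))
      = (\<Sum>k\<le>n. wt n z (n - k) * of_real (right (real (n - k) / real n) * G (real (n - k) / real n)))"
    by (rule sum.reindex_bij_witness[of _ "\<lambda>k. n - k" "\<lambda>k. n - k"]) auto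
  also have "\<dots> = (\<Sum>k\<le>n. wt n z k * of_real (right (1 - real k / real n) * G (real k / real n)))"
    by (intro sum.cong) (simp_all add: wt_reflect refl sym del: of_nat_diff)
  finally have "(\<Sum>k\<le>n. wt n z k * of_real (G (real k / real n)))
     - 2 * (\<Sum>k\<le>n. wt n z k * of_real (right (real k / real n) * G (real k / real n)))
    = (\<Sum>k\<le>n. wt n z k * of_real ((1 - right (real k / real n) - right (1 - real k / real n)) * G (real k / real n)))"
    by (simp add: left_diff_distrib right_diff_distrib sum_subtractf)
  also have "norm \<dots> \<le> (\<Sum>k\<le>n. awt n t k * (B * far n \<delta> k))"
  proof (rule norm_weighted_sum_le)
    fix k assume k: "k \<le> n"
    have B0: "0 \<le> B" using B[of 0] by simp
    show "norm (of_real ((1 - right (real k / real n) - right (1 - real k / real n)) * G (real k / real n)) :: complex) \<le> B * far n \<delta> k"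
    proof (cases "real k / real n = 1 / 2")
      case True
      have "far n \<delta> k = 1" using \<delta> p unfolding far_def True by auto
      moreover have "\<bar>G (1 / 2)\<bar> \<le> B" by (rule B) auto
      ultimately show ?thesis unfolding True by (simp add: right_def)
    next
      case False
      hence "1 - right (real k / real n) - right (1 - real k / real n) = 0"
        by (auto simp: right_def)
      thus ?thesis using B0 by simp
    qed
  qed fact
  also have "\<dots> = B * (\<Sum>k\<le>n. awt n t k * far n \<delta> k)"
    by (simp add: sum_distrib_left ac_simps)
  finally show ?thesis .
qed

text \<open>With \<open>\<kappa> = p * A'' p\<close> this is
  \<open>(\<phi>1 p)\<^sup>2 / (- A'' p)\<close>: the Gaussian variance at a well, transported to
  \<open>\<phi>\<close> by the delta method.\<close>

definition \<sigma>2 :: real where "\<sigma>2 = - (p * (\<phi>1 p)\<^sup>2) / \<kappa>"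

lemma \<sigma>2_pos: "\<sigma>2 > 0"
proof -
  have "p * (\<phi>1 p)\<^sup>2 > 0" using p phi1_p by simp
  thus ?thesis unfolding \<sigma>2_def using \<kappa> by (intro divide_neg_neg) auto
qed

text \<open>With the cut-off itself as test function, the leading a in the expansion of
  \<open>Q\<close> cancels against k/n and leaves the linear drift plus the tilt. The pointwise
  error \<open>C * (1 / n + x\<^sup>2)\<close> is summable by the second moment bound.\<close>

lemma stein_right:
  assumes "R \<ge> 0"
  obtains C where "C \<ge> 0" "\<And>n z. n \<ge> 1 \<Longrightarrow> Re z = t \<Longrightarrow> norm z \<le> R \<Longrightarrow>
     norm (of_real \<kappa> * (\<Sum>k\<le>n. wt n z k * of_real (right (real k / real n) * (real k / real n - p)))
        + z * of_real (p * \<phi>1 p / sqrt (real n)) * (\<Sum>k\<le>n. wt n z k * of_real (right (real k / real n))))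
     \<le> C / real n * Zr n t"
proof -
  obtain C where C: "C \<ge> 0" and CQ: "\<And>n k z. n \<ge> 1 \<Longrightarrow> k \<le> n \<Longrightarrow> norm z \<le> R \<Longrightarrow>
     norm (Q n z k - (of_real (real k / real n + \<kappa> * (real k / real n - p)) + z * of_real (p * \<phi>1 p / sqrt (real n))))
       \<le> C * (1 / real n + (real k / real n - p)\<^sup>2)"
    by (rule Q_expansion[OF assms]) auto
  define \<delta> where "\<delta> = (p - 1 / 2) / 2"
  have \<delta>: "\<delta> > 0" "\<delta> \<le> (p - 1 / 2) / 2" using p by (auto simp: \<delta>_def)
  obtain Cf where Cf: "Cf \<ge> 0" "\<And>n. n \<ge> 1 \<Longrightarrow> (\<Sum>k\<le>n. awt n t k * far n \<delta> k) \<le> Cf / real n * Zr n t"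
    by (rule far_sum_le[OF \<delta>(1), where t = t]) auto
  obtain Cs where Cs: "Cs \<ge> 0" "\<And>n. n \<ge> 1 \<Longrightarrow>
      (\<Sum>k\<le>n. awt n t k * (right (real k / real n) * (real k / real n - p)\<^sup>2)) \<le> Cs / real n * Zr n t"
    by (rule second_moment_le[where t = t]) auto
  define L where "L = \<bar>p * \<phi>1 p\<bar>"
  define M where "M = 1 + \<bar>\<kappa>\<bar> + R * L + 2 * C"
  define n0 where "n0 = 2 / (p - 1 / 2)"
  have nn: "L \<ge> 0" "M \<ge> 0" "n0 \<ge> 0" using assms C p by (auto simp: L_def M_def n0_def)
  show ?thesis
  proof (rule that[of "C + C * Cs + M * Cf + M * n0"])
    show "0 \<le> C + C * Cs + M * Cf + M * n0" using C Cs Cf nn by simp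
    fix n :: nat and z :: complex
    assume n: "n \<ge> 1" and z: "Re z = t" "norm z \<le> R"
    \<comment> \<open>The linearized summand minus the exact Stein summand. The latter sums to zero,
      so bounding this difference termwise bounds the linearized sum.\<close>
    define c where "c = (\<lambda>k. of_real (right (real k / real n)) * (of_real (\<kappa> * (real k / real n - p)) + z * of_real (p * \<phi>1 p / sqrt (real n)))
      - (Q n z k * of_real (right (real (Suc k) / real n)) - of_real (real k / real n * right (real k / real n))))"
    have "norm (\<Sum>k\<le>n. wt n z k * c k)
       \<le> (\<Sum>k\<le>n. awt n t k * (C * (1 / real n + right (real k / real n) * (real k / real n - p)\<^sup>2) + M * (far n \<delta> k + n0 / real n)))"
    proof (rule norm_weighted_sum_le[OF z(1)])
      fix k assume k: "k \<le> n"
      define a where "a = real k / real n"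
      define x where "x = a - p"
      have a: "a \<in> {0..1}" using frac_mem[OF k] by (simp add: a_def)
      have x1: "\<bar>x\<bar> \<le> 1" using a p by (auto simp: x_def)
      hence x2: "x\<^sup>2 \<le> 1" by (simp add: abs_square_le_1)
      have a': "real (Suc k) / real n = a + 1 / real n" by (simp add: a_def add_divide_distrib)
      have Q: "norm (Q n z k - (of_real (a + \<kappa> * x) + z * of_real (p * \<phi>1 p / sqrt (real n)))) \<le> C * (1 / real n + x\<^sup>2)"
        using CQ[OF n k z(2)] by (simp add: a_def x_def)
      have n1: "1 / real n \<le> 1" using n by simp
      have s1: "1 / sqrt (real n) \<le> 1" using n by simp
      show "norm (c k) \<le> C * (1 / real n + right (real k / real n) * (real k / real n - p)\<^sup>2) + M * (far n \<delta> k + n0 / real n)"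
      proof (cases "a > 1 / 2")
        case True
        hence r: "right (real k / real n) = 1" "right (real (Suc k) / real n) = 1"
          using right_Suc[of k n] by (auto simp: right_def a_def)
        have "c k = - (Q n z k - (of_real (a + \<kappa> * x) + z * of_real (p * \<phi>1 p / sqrt (real n))))"
          unfolding c_def r by (simp add: a_def x_def)
        hence "norm (c k) \<le> C * (1 / real n + x\<^sup>2)" using Q by (simp only: norm_minus_cancel)
        thus ?thesis unfolding r using nn by (simp add: a_def x_def add_increasing2)
      next
        case False
        hence r: "right (real k / real n) = 0" by (auto simp: right_def a_def)
        show ?thesis
        proof (cases "real (Suc k) / real n > 1 / 2")
          case True
          have "norm (c k) = norm (Q n z k)" using True unfolding c_def r by (simp add: right_def)
          also have "\<dots> \<le> norm (of_real (a + \<kappa> * x) + z * of_real (p * \<phi>1 p / sqrt (real n))) + C * (1 / real n + x\<^sup>2)"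
            using Q norm_triangle_sub[of "Q n z k"] by (rule order.trans[rotated, OF add_left_mono])
          also have "norm (of_real (a + \<kappa> * x) + z * of_real (p * \<phi>1 p / sqrt (real n))) \<le> \<bar>a + \<kappa> * x\<bar> + norm z * (L * (1 / sqrt (real n)))"
            by (rule order.trans[OF norm_triangle_ineq]) (simp only: norm_of_real norm_mult, simp add: L_def)
          also have "\<bar>a + \<kappa> * x\<bar> \<le> 1 + \<bar>\<kappa>\<bar>"
            using a mult_left_mono[OF x1, of "\<bar>\<kappa>\<bar>"] by (intro order.trans[OF abs_triangle_ineq]) (auto simp: abs_mult)
          also have "norm z * (L * (1 / sqrt (real n))) \<le> R * (L * 1)"
            using z s1 nn assms by (intro mult_mono mult_left_mono) auto
          also have "C * (1 / real n + x\<^sup>2) \<le> C * 2" using add_mono[OF n1 x2] C by (intro mult_left_mono) (simp_all only: one_add_one)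
          finally have "norm (c k) \<le> M * 1" by (simp add: M_def)
          also have "\<dots> \<le> M * (far n \<delta> k + n0 / real n)"
            unfolding n0_def using n False True \<delta> nn by (intro mult_left_mono crossing_le) (auto simp: a_def)
          finally show ?thesis unfolding r using C by (simp add: add_increasing)
        next
          case False
          hence "c k = 0" unfolding c_def r by (simp add: right_def)
          thus ?thesis unfolding r using nn C by simp
        qed
      qed
    qed
    also have "\<dots> = C / real n * Zr n t + C * (\<Sum>k\<le>n. awt n t k * (right (real k / real n) * (real k / real n - p)\<^sup>2))
        + M * (\<Sum>k\<le>n. awt n t k * far n \<delta> k) + M * n0 / real n * Zr n t"
      unfolding Zr_def by (simp add: distrib_left sum.distrib sum_distrib_left ac_simps)
    also have "\<dots> \<le> C / real n * Zr n t + C * (Cs / real n * Zr n t) + M * (Cf / real n * Zr n t) + M * n0 / real n * Zr n t"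
      using nn C Cf(2)[OF n] Cs(2)[OF n] by (intro add_mono mult_left_mono) auto
    also have "\<dots> = (C + C * Cs + M * Cf + M * n0) / real n * Zr n t"
      by (simp add: algebra_simps add_divide_distrib)
    finally have bound: "norm (\<Sum>k\<le>n. wt n z k * c k) \<le> (C + C * Cs + M * Cf + M * n0) / real n * Zr n t" .
    have "(\<Sum>k\<le>n. wt n z k * c k) =
       of_real \<kappa> * (\<Sum>k\<le>n. wt n z k * of_real (right (real k / real n) * (real k / real n - p)))
        + z * of_real (p * \<phi>1 p / sqrt (real n)) * (\<Sum>k\<le>n. wt n z k * of_real (right (real k / real n)))
        - (\<Sum>k\<le>n. wt n z k * (Q n z k * of_real (right (real (Suc k) / real n))
            - of_real (real k / real n * right (real k / real n))))"
    proof -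
      have "w * (r * (y + l) - u) = w * (r * y) + l * (w * r) - w * u" for w r y l u :: complex
        by (simp add: algebra_simps)
      thus ?thesis
        unfolding sum_distrib_left sum.distrib[symmetric] sum_subtractf[symmetric] c_def
        by (intro sum.cong refl) (simp only: of_real_mult mult.assoc mult.left_commute[of "of_real \<kappa>"])
    qed
    also have "\<dots> = of_real \<kappa> * (\<Sum>k\<le>n. wt n z k * of_real (right (real k / real n) * (real k / real n - p)))
        + z * of_real (p * \<phi>1 p / sqrt (real n)) * (\<Sum>k\<le>n. wt n z k * of_real (right (real k / real n)))"
      using stein_identity[of n z right] n by simp
    finally have eq: "(\<Sum>k\<le>n. wt n z k * c k) = of_real \<kappa> * (\<Sum>k\<le>n. wt n z k * of_real (right (real k / real n) * (real k / real n - p)))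
        + z * of_real (p * \<phi>1 p / sqrt (real n)) * (\<Sum>k\<le>n. wt n z k * of_real (right (real k / real n)))" .
    show "norm (of_real \<kappa> * (\<Sum>k\<le>n. wt n z k * of_real (right (real k / real n) * (real k / real n - p)))
        + z * of_real (p * \<phi>1 p / sqrt (real n)) * (\<Sum>k\<le>n. wt n z k * of_real (right (real k / real n))))
      \<le> (C + C * Cs + M * Cf + M * n0) / real n * Zr n t" 
      using bound unfolding eq .
  qed
qed

text \<open>
  Real \<open>z\<close> gives the mean of the tilted measure, imaginary \<open>z\<close> a differential equation for the
  characteristic function that is satisfied up to \<open>O(1 / sqrt n)\<close>.
\<close>

lemma weighted_mean_expansion:
  assumes "R \<ge> 0"
  obtains C where "C \<ge> 0" "\<And>n z. n \<ge> 1 \<Longrightarrow> Re z = t \<Longrightarrow> norm z \<le> R \<Longrightarrow>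
     norm (of_real (sqrt (real n)) * (\<Sum>k\<le>n. wt n z k * of_real (\<phi> (real k / real n)))
        - of_real \<sigma>2 * z * (\<Sum>k\<le>n. wt n z k)) \<le> C / sqrt (real n) * Zr n t"
proof -
  define \<delta> where "\<delta> = (p - 1 / 2) / 2"
  have \<delta>: "\<delta> > 0" "\<delta> \<le> (p - 1 / 2) / 2" using p by (auto simp: \<delta>_def)
  obtain Cf where Cf: "Cf \<ge> 0" "\<And>n. n \<ge> 1 \<Longrightarrow> (\<Sum>k\<le>n. awt n t k * far n \<delta> k) \<le> Cf / real n * Zr n t"
    by (rule far_sum_le[OF \<delta>(1), where t = t]) auto
  obtain Cs where Cs: "Cs \<ge> 0" "\<And>n. n \<ge> 1 \<Longrightarrow>
      (\<Sum>k\<le>n. awt n t k * (right (real k / real n) * (real k / real n - p)\<^sup>2)) \<le> Cs / real n * Zr n t"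
    by (rule second_moment_le[where t = t]) auto
  obtain C3 where C3: "C3 \<ge> 0" "\<And>n z. n \<ge> 1 \<Longrightarrow> Re z = t \<Longrightarrow> norm z \<le> R \<Longrightarrow>
     norm (of_real \<kappa> * (\<Sum>k\<le>n. wt n z k * of_real (right (real k / real n) * (real k / real n - p)))
        + z * of_real (p * \<phi>1 p / sqrt (real n)) * (\<Sum>k\<le>n. wt n z k * of_real (right (real k / real n))))
     \<le> C3 / real n * Zr n t"
    by (rule stein_right[OF assms, where t = t]) auto
  define A where "A = 2 * \<bar>\<phi>1 p / \<kappa>\<bar> * C3 + 2 * (K * Cs) + K * Cf"
  have A: "A \<ge> 0" using C3 Cs Cf K_nonneg by (auto simp: A_def)
  show ?thesis
  proof (rule that[of "A + \<sigma>2 * R * Cf"])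
    show "0 \<le> A + \<sigma>2 * R * Cf" using A \<sigma>2_pos assms Cf by simp
    fix n :: nat and z :: complex
    assume n: "n \<ge> 1" and z: "Re z = t" "norm z \<le> R"
    define s where "s = sqrt (real n)"
    have s: "s > 0" "s * s = real n" "1 \<le> s" using n by (auto simp: s_def)
    define W where "W = (\<Sum>k\<le>n. wt n z k)"
    define WH where "WH = (\<Sum>k\<le>n. wt n z k * of_real (right (real k / real n)))"
    define X where "X = (\<Sum>k\<le>n. wt n z k * of_real (right (real k / real n) * (real k / real n - p)))"
    define P where "P = (\<Sum>k\<le>n. wt n z k * of_real (\<phi> (real k / real n)))"
    define PH where "PH = (\<Sum>k\<le>n. wt n z k * of_real (right (real k / real n) * \<phi> (real k / real n)))"
    \<comment> \<open>Four error sources, each O(\<open>Z\<close>): \<open>E1\<close> and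
      \<open>E4\<close> come from passing to the right half, \<open>E2\<close> from the Taylor
      expansion of \<open>\<phi>\<close> at \<open>p\<close>, and \<open>E3\<close> from Stein's
      identity.\<close>
    define E1 where "E1 = P - 2 * PH"
    define E2 where "E2 = PH - of_real (\<phi>1 p) * X"
    define E3 where "E3 = of_real \<kappa> * X + z * of_real (p * \<phi>1 p / s) * WH"
    define E4 where "E4 = W - 2 * WH"
    define Z where "Z = Zr n t / real n"
    have Z0: "Z \<ge> 0" using Zr_pos[of n t] by (simp add: Z_def)
    have far: "(\<Sum>k\<le>n. awt n t k * far n \<delta> k) \<le> Cf * Z" using Cf(2)[OF n] by (simp add: Z_def)
    have "norm E1 \<le> K * (\<Sum>k\<le>n. awt n t k * far n \<delta> k)"
      unfolding E1_def P_def PH_def by (rule symmetric_sum[OF n \<delta>(2) z(1), where G = \<phi> and B = K, OF phi_sym phi_bound])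
    also have "\<dots> \<le> K * (Cf * Z)" using far K_nonneg by (rule mult_left_mono)
    finally have E1: "norm E1 \<le> K * Cf * Z" by simp
    have "norm E4 \<le> 1 * (\<Sum>k\<le>n. awt n t k * far n \<delta> k)"
      using symmetric_sum[OF n \<delta>(2) z(1), of "\<lambda>_. 1" 1] by (simp add: E4_def W_def WH_def)
    with far have E4: "norm E4 \<le> Cf * Z" by simp
    have E3: "norm E3 \<le> C3 * Z" using C3(2)[OF n z] by (simp add: E3_def X_def WH_def s_def Z_def)
    have E2_eq: "E2 = (\<Sum>k\<le>n. wt n z k * of_real (right (real k / real n) * (\<phi> (real k / real n) - \<phi>1 p * (real k / real n - p))))"
      unfolding E2_def PH_def X_def sum_distrib_left sum_subtractf[symmetric]
      by (intro sum.cong refl) (simp add: algebra_simps)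
    have "norm E2 \<le> (\<Sum>k\<le>n. awt n t k * (right (real k / real n) * (K * (real k / real n - p)\<^sup>2)))"
      unfolding E2_eq
    proof (intro norm_weighted_sum_le z)
      fix k assume "k \<le> n"
      define a where "a = real k / real n"
      have a: "a \<in> {0..1}" unfolding a_def by (rule frac_mem) fact
      have "\<bar>\<phi> a - \<phi> p - (a - p) * \<phi>1 p\<bar> \<le> K * (a - p)\<^sup>2"
        by (rule phi_taylor) (use a p in auto)
      hence "\<bar>\<phi> a - \<phi>1 p * (a - p)\<bar> \<le> K * (a - p)\<^sup>2"
        by (simp only: phi_p diff_zero mult.commute[of "\<phi>1 p"])
      hence "right a * \<bar>\<phi> a - \<phi>1 p * (a - p)\<bar> \<le> right a * (K * (a - p)\<^sup>2)"
        by (rule mult_left_mono) simp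
      thus "norm (of_real (right (real k / real n) * (\<phi> (real k / real n) - \<phi>1 p * (real k / real n - p))) :: complex)
          \<le> right (real k / real n) * (K * (real k / real n - p)\<^sup>2)"
        unfolding a_def[symmetric] by (simp only: norm_of_real abs_mult abs_of_nonneg right_bounds)
    qed
    also have "\<dots> = K * (\<Sum>k\<le>n. awt n t k * (right (real k / real n) * (real k / real n - p)\<^sup>2))"
      by (simp add: sum_distrib_left ac_simps)
    also have "\<dots> \<le> K * (Cs / real n * Zr n t)" using Cs(2)[OF n] K_nonneg by (rule mult_left_mono)
    finally have E2: "norm E2 \<le> K * Cs * Z" by (simp add: Z_def)
    have \<sigma>: "of_real \<sigma>2 = - (of_real p * of_real (\<phi>1 p) ^ 2 / of_real \<kappa> :: complex)"
      by (simp add: \<sigma>2_def)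
    have X: "X = (E3 - z * of_real (p * \<phi>1 p / s) * WH) / of_real \<kappa>"
      using \<kappa> by (simp add: E3_def)
    have "of_real s * P - of_real \<sigma>2 * z * W = of_real s * (E1 + 2 * E2 + 2 * of_real (\<phi>1 p) * X) - of_real \<sigma>2 * z * (E4 + 2 * WH)"
      by (simp add: E1_def E2_def E4_def right_diff_distrib)
    \<comment> \<open>The contributions of \<open>WH\<close> cancel exactly; this requirement
      determines \<open>\<sigma>2\<close>.\<close>
    also have "\<dots> = of_real s * (of_real (2 * (\<phi>1 p / \<kappa>)) * E3 + 2 * E2 + E1) - of_real \<sigma>2 * z * E4"
    proof -
      have "u * (e1 + 2 * e2 + 2 * b * ((e3 - z * (q * b / u) * v) / l)) - - (q * b ^ 2 / l) * z * (e4 + 2 * v)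
          = u * (2 * (b / l) * e3 + 2 * e2 + e1) - - (q * b ^ 2 / l) * z * e4"
        if "u \<noteq> 0" "l \<noteq> 0" for u e1 e2 e3 e4 b q v l :: complex
        using that by (simp add: divide_simps) (simp add: algebra_simps power2_eq_square)
      from this[of "of_real s" "of_real \<kappa>"] show ?thesis
        unfolding \<sigma> X using \<kappa> s by simp
    qed
    also have "norm \<dots> \<le> s * (2 * \<bar>\<phi>1 p / \<kappa>\<bar> * (C3 * Z) + 2 * (K * Cs * Z) + K * Cf * Z) + \<sigma>2 * R * (Cf * Z)"
    proof (rule order.trans[OF norm_triangle_ineq4 add_mono])
      show "norm (of_real s * (of_real (2 * (\<phi>1 p / \<kappa>)) * E3 + 2 * E2 + E1))
         \<le> s * (2 * \<bar>\<phi>1 p / \<kappa>\<bar> * (C3 * Z) + 2 * (K * Cs * Z) + K * Cf * Z)"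
      proof -
        have "norm (of_real (2 * (\<phi>1 p / \<kappa>)) * E3 + 2 * E2 + E1) \<le> norm (of_real (2 * (\<phi>1 p / \<kappa>)) * E3) + norm (2 * E2) + norm E1"
          by (intro order.trans[OF norm_triangle_ineq] add_mono order.refl)
        also have "norm (of_real (2 * (\<phi>1 p / \<kappa>)) * E3) = 2 * \<bar>\<phi>1 p / \<kappa>\<bar> * norm E3"
          unfolding norm_mult norm_of_real by (simp add: abs_mult)
        also have "\<dots> \<le> 2 * \<bar>\<phi>1 p / \<kappa>\<bar> * (C3 * Z)" using E3 by (intro mult_left_mono) auto
        finally show ?thesis using E1 E2 s by (simp add: norm_mult)
      qed
      show "norm (of_real \<sigma>2 * z * E4) \<le> \<sigma>2 * R * (Cf * Z)"
        unfolding norm_mult using \<sigma>2_pos z E4 assms by (intro mult_mono) auto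
    qed
    also have "\<dots> = s * (A * Z) + \<sigma>2 * R * Cf * Z"
      unfolding A_def distrib_right by (simp only: mult.assoc)
    also have "\<dots> \<le> s * (A * Z) + s * (\<sigma>2 * R * Cf * Z)"
    proof -
      have "1 * (\<sigma>2 * R * Cf * Z) \<le> s * (\<sigma>2 * R * Cf * Z)"
        using s \<sigma>2_pos assms Cf Z0 by (intro mult_right_mono) auto
      thus ?thesis by simp
    qed
    also have "\<dots> = (A + \<sigma>2 * R * Cf) * (s * Z)"
      unfolding distrib_right by (simp only: mult.left_commute mult.assoc)
    also have "s * Z = Zr n t / s"
      unfolding Z_def s(2)[symmetric] using s(1) by simp
    also have "(A + \<sigma>2 * R * Cf) * (Zr n t / s) = (A + \<sigma>2 * R * Cf) / s * Zr n t" by simp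
    finally show "norm (of_real (sqrt (real n)) * (\<Sum>k\<le>n. wt n z k * of_real (\<phi> (real k / real n)))
        - of_real \<sigma>2 * z * (\<Sum>k\<le>n. wt n z k)) \<le> (A + \<sigma>2 * R * Cf) / sqrt (real n) * Zr n t"
      unfolding P_def W_def s_def .
  qed
qed


section \<open>Limits of the tilted means and of the characteristic functions\<close>

lemma tilted_mean_tendsto:
  "(\<lambda>n. sqrt (real n) * ((\<Sum>k\<le>n. awt n t k * \<phi> (real k / real n)) / Zr n t)) \<longlonglongrightarrow> \<sigma>2 * t"
proof -
  obtain C where C: "C \<ge> 0" "\<And>n z. n \<ge> 1 \<Longrightarrow> Re z = t \<Longrightarrow> norm z \<le> \<bar>t\<bar> \<Longrightarrow>
     norm (of_real (sqrt (real n)) * (\<Sum>k\<le>n. wt n z k * of_real (\<phi> (real k / real n)))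
        - of_real \<sigma>2 * z * (\<Sum>k\<le>n. wt n z k)) \<le> C / sqrt (real n) * Zr n t"
    by (rule weighted_mean_expansion[of "\<bar>t\<bar>" t]) auto
  have "\<bar>sqrt (real n) * ((\<Sum>k\<le>n. awt n t k * \<phi> (real k / real n)) / Zr n t) - \<sigma>2 * t\<bar> \<le> C / sqrt (real n)"
    if n: "n \<ge> 1" for n
  proof -
    define S where "S = (\<Sum>k\<le>n. awt n t k * \<phi> (real k / real n))"
    have S: "(\<Sum>k\<le>n. wt n (of_real t) k * of_real (\<phi> (real k / real n))) = of_real S"
      unfolding S_def wt_of_real by simp
    have Z: "(\<Sum>k\<le>n. wt n (of_real t) k) = of_real (Zr n t)"
      unfolding Zr_def wt_of_real by simp
    have "norm (of_real (sqrt (real n) * S - \<sigma>2 * t * Zr n t) :: complex) \<le> C / sqrt (real n) * Zr n t"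
      using C(2)[OF n, of "of_real t"] unfolding S Z by simp
    hence "\<bar>sqrt (real n) * S - \<sigma>2 * t * Zr n t\<bar> / Zr n t \<le> C / sqrt (real n)"
      using Zr_pos[of n t] unfolding norm_of_real by (simp only: pos_divide_le_eq)
    also have "\<bar>sqrt (real n) * S - \<sigma>2 * t * Zr n t\<bar> / Zr n t = \<bar>(sqrt (real n) * S - \<sigma>2 * t * Zr n t) / Zr n t\<bar>"
      using Zr_pos[of n t] by simp
    also have "(sqrt (real n) * S - \<sigma>2 * t * Zr n t) / Zr n t = sqrt (real n) * (S / Zr n t) - \<sigma>2 * t"
      using Zr_pos[of n t] by (simp add: field_simps)
    finally show ?thesis by (simp add: S_def)
  qed
  hence "\<forall>\<^sub>F n in sequentially. norm (sqrt (real n) * ((\<Sum>k\<le>n. awt n t k * \<phi> (real k / real n)) / Zr n t) - \<sigma>2 * t) \<le> C / sqrt (real n)"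
    unfolding eventually_sequentially real_norm_def by blast
  moreover have "(\<lambda>n. C / sqrt (real n)) \<longlonglongrightarrow> 0" by real_asymp
  ultimately have "(\<lambda>n. sqrt (real n) * ((\<Sum>k\<le>n. awt n t k * \<phi> (real k / real n)) / Zr n t) - \<sigma>2 * t) \<longlonglongrightarrow> 0"
    by (rule Lim_null_comparison)
  thus ?thesis by (rule LIM_zero_cancel)
qed

lemma wt_has_field_derivative:
  "((\<lambda>z. wt n z k) has_field_derivative wt n z k * of_real (sqrt (real n) * \<phi> (real k / real n))) (at z within S)"
  unfolding wt_def by (auto intro!: derivative_eq_intros)

lemma char_tendsto:
  "(\<lambda>n. (\<Sum>k\<le>n. wt n (\<i> * of_real s) k) / of_real (Zr n 0)) \<longlonglongrightarrow> of_real (exp (- (\<sigma>2 * s\<^sup>2 / 2)))"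
proof -
  \<comment> \<open>The integrating factor of the equation W' = \<open>\<sigma>2 * z * W\<close>.
    Its derivative contains only the defect \<open>D\<close>, so \<open>G\<close> stays within
    O(1/sqrt n) of its value 1 at the origin along the imaginary segment. There \<open>Re z\<close>
    is 0, and all defects are relative to the same \<open>Zr n 0\<close>.\<close>
  define G where "G = (\<lambda>n z. exp (- (of_real \<sigma>2 * z\<^sup>2 / 2)) * ((\<Sum>k\<le>n. wt n z k) / of_real (Zr n 0)))"
  define D where "D = (\<lambda>n z. of_real (sqrt (real n)) * (\<Sum>k\<le>n. wt n z k * of_real (\<phi> (real k / real n)))
        - of_real \<sigma>2 * z * (\<Sum>k\<le>n. wt n z k))"
  obtain C where C: "C \<ge> 0" "\<And>n z. n \<ge> 1 \<Longrightarrow> Re z = 0 \<Longrightarrow> norm z \<le> \<bar>s\<bar> \<Longrightarrow> norm (D n z) \<le> C / sqrt (real n) * Zr n 0"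
    unfolding D_def by (rule weighted_mean_expansion[of "\<bar>s\<bar>" 0]) auto
  have deriv: "(G n has_field_derivative exp (- (of_real \<sigma>2 * z\<^sup>2 / 2)) * (D n z / of_real (Zr n 0))) (at z within S)" for n z S
  proof -
    have d: "((\<lambda>z. \<Sum>k\<le>n. wt n z k) has_field_derivative (\<Sum>k\<le>n. wt n z k * of_real (sqrt (real n) * \<phi> (real k / real n)))) (at z within S)"
      by (intro DERIV_sum wt_has_field_derivative)
    have e: "(\<Sum>k\<le>n. wt n z k * of_real (sqrt (real n) * \<phi> (real k / real n)))
        = of_real (sqrt (real n)) * (\<Sum>k\<le>n. wt n z k * of_real (\<phi> (real k / real n)))"
      by (simp add: sum_distrib_left ac_simps)
    have g: "((\<lambda>z. exp (- (of_real \<sigma>2 * z\<^sup>2 / 2))) has_field_derivative exp (- (of_real \<sigma>2 * z\<^sup>2 / 2)) * - (of_real \<sigma>2 * z)) (at z within S)"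
      by (auto intro!: derivative_eq_intros simp: field_simps)
    show ?thesis
      unfolding G_def D_def
      by (rule DERIV_cong[OF DERIV_mult[OF g DERIV_cdivide[OF d[unfolded e]]]]) (use Zr_pos[of n 0] in \<open>simp add: field_simps\<close>)
  qed
  have bound: "norm (G n (\<i> * of_real s) - 1) \<le> exp (\<sigma>2 * s\<^sup>2 / 2) * (C / sqrt (real n)) * \<bar>s\<bar>" if n: "n \<ge> 1" for n
  proof -
    have "norm (G n (\<i> * of_real s) - G n 0) \<le> exp (\<sigma>2 * s\<^sup>2 / 2) * (C / sqrt (real n)) * norm (\<i> * of_real s - 0)"
    proof (rule field_differentiable_bound[OF convex_closed_segment[of 0 "\<i> * of_real s"] deriv])
      fix z assume "z \<in> closed_segment 0 (\<i> * of_real s)"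
      then obtain u where u: "0 \<le> u" "u \<le> 1" "z = \<i> * of_real (u * s)"
        by (auto simp: in_segment scaleR_conv_of_real mult_ac)
      have z: "Re z = 0" "norm z \<le> \<bar>s\<bar>"
        using u by (auto simp: norm_mult mult_left_le_one_le abs_mult)
      have "norm (exp (- (of_real \<sigma>2 * z\<^sup>2 / 2))) \<le> exp (norm (- (of_real \<sigma>2 * z\<^sup>2 / 2)))"
        by (rule norm_exp)
      also have "norm (- (of_real \<sigma>2 * z\<^sup>2 / 2)) = \<sigma>2 * (norm z)\<^sup>2 / 2"
        using \<sigma>2_pos by (simp add: norm_mult norm_power norm_divide)
      also have "exp (\<sigma>2 * (norm z)\<^sup>2 / 2) \<le> exp (\<sigma>2 * s\<^sup>2 / 2)"
        using \<sigma>2_pos power_mono[OF z(2), of 2] by simp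
      finally have e: "norm (exp (- (of_real \<sigma>2 * z\<^sup>2 / 2))) \<le> exp (\<sigma>2 * s\<^sup>2 / 2)" .
      have "norm (D n z / of_real (Zr n 0)) = norm (D n z) / Zr n 0"
        using Zr_pos[of n 0] by (simp add: norm_divide)
      also have "\<dots> \<le> C / sqrt (real n)"
        using C(2)[OF n z] Zr_pos[of n 0] by (simp only: pos_divide_le_eq)
      finally have "norm (D n z / of_real (Zr n 0)) \<le> C / sqrt (real n)" .
      with e show "norm (exp (- (of_real \<sigma>2 * z\<^sup>2 / 2)) * (D n z / of_real (Zr n 0))) \<le> exp (\<sigma>2 * s\<^sup>2 / 2) * (C / sqrt (real n))"
        unfolding norm_mult by (intro mult_mono) auto
    qed auto
    moreover have "G n 0 = 1"
      using Zr_pos[of n 0] wt_of_real[of n 0] by (simp add: G_def Zr_def flip: of_real_sum)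
    ultimately show ?thesis by (simp add: norm_mult)
  qed
  have "(\<lambda>n. G n (\<i> * of_real s) - 1) \<longlonglongrightarrow> 0"
  proof (rule Lim_null_comparison)
    show "\<forall>\<^sub>F n in sequentially. norm (G n (\<i> * of_real s) - 1) \<le> exp (\<sigma>2 * s\<^sup>2 / 2) * (C / sqrt (real n)) * \<bar>s\<bar>"
      unfolding eventually_sequentially using bound by blast
    have "(\<lambda>n. C / sqrt (real n)) \<longlonglongrightarrow> 0" by real_asymp
    thus "(\<lambda>n. exp (\<sigma>2 * s\<^sup>2 / 2) * (C / sqrt (real n)) * \<bar>s\<bar>) \<longlonglongrightarrow> 0"
      by (intro tendsto_mult_left_zero tendsto_mult_right_zero)
  qed
  hence "(\<lambda>n. G n (\<i> * of_real s)) \<longlonglongrightarrow> 1" by (rule LIM_zero_cancel)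
  hence "(\<lambda>n. of_real (exp (- (\<sigma>2 * s\<^sup>2 / 2))) * G n (\<i> * of_real s)) \<longlonglongrightarrow> of_real (exp (- (\<sigma>2 * s\<^sup>2 / 2))) * 1"
    by (intro tendsto_mult tendsto_const)
  moreover have "of_real (exp (- (\<sigma>2 * s\<^sup>2 / 2))) * G n (\<i> * of_real s) = (\<Sum>k\<le>n. wt n (\<i> * of_real s) k) / of_real (Zr n 0)" for n
  proof -
    have 1: "- (of_real \<sigma>2 * (\<i> * of_real s)\<^sup>2 / 2) = (of_real (\<sigma>2 * s\<^sup>2 / 2) :: complex)"
      by (simp add: power_mult_distrib)
    have 2: "of_real (exp (- (\<sigma>2 * s\<^sup>2 / 2))) * exp (of_real (\<sigma>2 * s\<^sup>2 / 2)) = (1 :: complex)"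
      unfolding exp_of_real of_real_mult[symmetric] exp_add[symmetric] by simp
    show ?thesis unfolding G_def 1 mult.assoc[symmetric] 2 by (rule mult_1_left)
  qed
  ultimately show ?thesis by simp
qed

end

section \<open>The four-spin measure\<close>

lemma finite_spins [simp, intro]: "finite (spins n)"
  unfolding spins_def by (intro finite_PiE) auto

lemma spins_nonempty: "spins n \<noteq> {}"
  unfolding spins_def by (simp add: PiE_eq_empty_iff)

text \<open>Configurations correspond to their sets of plus sites, which are then grouped by
  cardinality. The general semiring permits real weights as well as complex exponentials.\<close>

lemma sum_spins:
  fixes F :: "real \<Rightarrow> 'a::comm_semiring_1"
  shows "(\<Sum>\<omega>\<in>spins n. F (frac_plus n \<omega>)) = (\<Sum>k\<le>n. of_nat (n choose k) * F (real k / real n))"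
proof -
  have "(\<Sum>\<omega>\<in>spins n. F (frac_plus n \<omega>)) = (\<Sum>A\<in>Pow {..<n}. F (real (card A) / real n))"
  proof (rule sum.reindex_bij_witness[of _ "\<lambda>A. restrict (\<lambda>i. if i \<in> A then 1 else -1) {..<n}" "\<lambda>\<omega>. {i \<in> {..<n}. \<omega> i = 1}"])
    fix \<omega> assume "\<omega> \<in> spins n"
    thus "restrict (\<lambda>i. if i \<in> {i \<in> {..<n}. \<omega> i = 1} then 1 else - 1) {..<n} = \<omega>"
      unfolding spins_def by (auto simp: PiE_iff extensional_def restrict_def fun_eq_iff)
  qed (auto simp: spins_def frac_plus_def)
  also have "\<dots> = (\<Sum>k\<le>n. \<Sum>A\<in>{A \<in> Pow {..<n}. card A = k}. F (real (card A) / real n))"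
  proof (rule sum.group[symmetric])
    show "card ` Pow {..<n} \<subseteq> {..n}"
      using card_mono[of "{..<n}"] by fastforce
  qed simp_all
  also have "\<dots> = (\<Sum>k\<le>n. of_nat (n choose k) * F (real k / real n))"
  proof (rule sum.cong)
    fix k assume "k \<in> {..n}"
    have "card {A. A \<subseteq> {..<n} \<and> card A = k} = n choose k"
      using n_subsets[of "{..<n}" k] by simp
    thus "(\<Sum>A\<in>{A \<in> Pow {..<n}. card A = k}. F (real (card A) / real n)) = of_nat (n choose k) * F (real k / real n)"
      by simp
  qed simp
  finally show ?thesis .
qed

definition gibbs_sum :: "nat \<Rightarrow> real \<Rightarrow> real \<Rightarrow> real" where
  "gibbs_sum n \<beta> h = (\<Sum>\<omega>\<in>spins n. gibbs_weight n \<beta> h \<omega>)"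

lemma gibbs_weight_pos: "0 < gibbs_weight n \<beta> h \<omega>"
  by (simp add: gibbs_weight_def)

lemma gibbs_sum_pos: "0 < gibbs_sum n \<beta> h"
  unfolding gibbs_sum_def by (intro sum_pos gibbs_weight_pos spins_nonempty) auto

lemma space_four_spin [simp]: "space (four_spin_measure n \<beta> h) = spins n"
  and sets_four_spin [simp]: "sets (four_spin_measure n \<beta> h) = Pow (spins n)"
  by (simp_all add: four_spin_measure_def space_point_measure sets_point_measure)

lemma measurable_four_spin [simp]:
  "f \<in> measurable (four_spin_measure n \<beta> h) M \<longleftrightarrow> f \<in> spins n \<rightarrow> space M"
  unfolding four_spin_measure_def measurable_point_measure_eq1 ..

lemma prob_space_four_spin: "prob_space (four_spin_measure n \<beta> h)"
proof (rule prob_spaceI)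
  have "emeasure (four_spin_measure n \<beta> h) (spins n)
      = (\<Sum>\<omega>\<in>spins n. ennreal (gibbs_weight n \<beta> h \<omega> / gibbs_sum n \<beta> h))"
    unfolding four_spin_measure_def gibbs_sum_def[symmetric]
    by (rule emeasure_point_measure_finite2) auto
  also have "\<dots> = ennreal (\<Sum>\<omega>\<in>spins n. gibbs_weight n \<beta> h \<omega> / gibbs_sum n \<beta> h)"
    using gibbs_sum_pos gibbs_weight_pos by (intro sum_ennreal divide_nonneg_pos) (auto intro: less_imp_le)
  also have "(\<Sum>\<omega>\<in>spins n. gibbs_weight n \<beta> h \<omega> / gibbs_sum n \<beta> h) = 1"
    using gibbs_sum_pos[of n \<beta> h] unfolding sum_divide_distrib[symmetric] by (simp flip: gibbs_sum_def)
  finally show "emeasure (four_spin_measure n \<beta> h) (space (four_spin_measure n \<beta> h)) = 1" by simp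
qed

lemma integral_four_spin:
  fixes G :: "real \<Rightarrow> 'a::{banach, second_countable_topology, real_algebra_1, comm_semiring_1}"
  shows "(\<integral>\<eta>. G (frac_plus n \<eta>) \<partial>four_spin_measure n \<beta> h) =
     (\<Sum>k\<le>n. of_nat (n choose k) * of_real (exp (real n * four_spin_f \<beta> h (real k / real n))) * G (real k / real n))
       /\<^sub>R gibbs_sum n \<beta> h"
proof -
  have "(\<integral>\<eta>. G (frac_plus n \<eta>) \<partial>four_spin_measure n \<beta> h)
     = (\<Sum>\<eta>\<in>spins n. (gibbs_weight n \<beta> h \<eta> / gibbs_sum n \<beta> h) *\<^sub>R G (frac_plus n \<eta>))"
    unfolding four_spin_measure_def gibbs_sum_def[symmetric]
    by (rule lebesgue_integral_point_measure_finite)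
      (auto intro: less_imp_le divide_nonneg_pos gibbs_sum_pos gibbs_weight_pos)
  also have "\<dots> = (\<Sum>\<eta>\<in>spins n. of_real (exp (real n * four_spin_f \<beta> h (frac_plus n \<eta>))) * G (frac_plus n \<eta>)) /\<^sub>R gibbs_sum n \<beta> h"
    by (simp add: gibbs_weight_def scaleR_sum_right scaleR_conv_of_real divide_inverse sum_distrib_left mult_ac)
  also have "(\<Sum>\<eta>\<in>spins n. of_real (exp (real n * four_spin_f \<beta> h (frac_plus n \<eta>))) * G (frac_plus n \<eta>))
     = (\<Sum>k\<le>n. of_nat (n choose k) * (of_real (exp (real n * four_spin_f \<beta> h (real k / real n))) * G (real k / real n)))"
    by (rule sum_spins[where F = "\<lambda>a. of_real (exp (real n * four_spin_f \<beta> h a)) * G a"])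
  finally show ?thesis by (simp add: mult.assoc)
qed

lemma gibbs_sum_eq:
  "gibbs_sum n \<beta> h = (\<Sum>k\<le>n. real (n choose k) * exp (real n * four_spin_f \<beta> h (real k / real n)))"
  unfolding gibbs_sum_def gibbs_weight_def
  by (rule sum_spins[where F = "\<lambda>a. exp (real n * four_spin_f \<beta> h a)", unfolded of_nat_id])

text \<open>Linearity in the parameters is what makes a parameter shift in direction (b, c) an
  exponential tilt by \<open>four_spin_f b c\<close>.\<close>

lemma four_spin_f_add: "four_spin_f (\<beta> + x) (h + y) a = four_spin_f \<beta> h a + four_spin_f x y a"
  by (simp add: four_spin_f_def algebra_simps)

lemma four_spin_f_scale: "four_spin_f (b * x) (c * x) a = x * four_spin_f b c a"
  by (simp add: four_spin_f_def algebra_simps)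

lemma four_spin_f_reflect: "four_spin_f \<beta> h (1 - a) = four_spin_f \<beta> h a"
proof -
  have m: "2 * (1 - a) - 1 = - (2 * a - 1)" by simp
  show ?thesis unfolding four_spin_f_def m power_minus_Bit0 ..
qed

section \<open>Limit law of the estimators\<close>

text \<open>Chebyshev's symmetrization replaces the computation of the derivative as a variance: the
  cross-multiplied difference is a double sum whose terms, paired with their transposes, are
  nonnegative, and strictly positive for the pair (i, j).\<close>

lemma tilted_mean_strict_mono:
  fixes w g :: "'a \<Rightarrow> real"
  assumes fin: "finite I" and w: "\<And>k. k \<in> I \<Longrightarrow> 0 < w k"
    and ij: "i \<in> I" "j \<in> I" "g i \<noteq> g j" and xy: "x < y"
  shows "(\<Sum>k\<in>I. w k * exp (x * g k) * g k) / (\<Sum>k\<in>I. w k * exp (x * g k))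
       < (\<Sum>k\<in>I. w k * exp (y * g k) * g k) / (\<Sum>k\<in>I. w k * exp (y * g k))"
proof -
  define A where "A = (\<lambda>x. \<Sum>k\<in>I. w k * exp (x * g k))"
  define B where "B = (\<lambda>x. \<Sum>k\<in>I. w k * exp (x * g k) * g k)"
  have A: "A x > 0" for x
    unfolding A_def using fin w ij(1) by (intro sum_pos) auto
  define T where "T = (\<lambda>k l. w k * w l * (exp (x * g k) * exp (y * g l) * (g l - g k)))"
  have T: "T k l + T l k = w k * w l * (exp (x * g k + y * g l) - exp (x * g l + y * g k)) * (g l - g k)" for k l
    by (simp add: T_def exp_add algebra_simps)
  have sgn: "(x * g k + y * g l) - (x * g l + y * g k) = (y - x) * (g l - g k)" for k l
    by (simp add: algebra_simps)
  have prod: "(exp (x * g k + y * g l) - exp (x * g l + y * g k)) * (g l - g k) > 0" if "g k \<noteq> g l" for k l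
  proof (cases "g k < g l")
    case True
    hence "(y - x) * (g l - g k) > 0" using xy by simp
    hence "exp (x * g l + y * g k) < exp (x * g k + y * g l)" using sgn[of k l] by simp
    thus ?thesis using True by simp
  next
    case False
    hence lt: "g l < g k" using that by simp
    hence "(y - x) * (g l - g k) < 0" using xy by (simp add: mult_pos_neg)
    hence "exp (x * g k + y * g l) < exp (x * g l + y * g k)" using sgn[of k l] by simp
    thus ?thesis using lt by (intro mult_neg_neg) auto
  qed
  have nonneg: "T k l + T l k \<ge> 0" if "k \<in> I" "l \<in> I" for k l
  proof (cases "g k = g l")
    case False
    show ?thesis unfolding T mult.assoc
      by (rule mult_nonneg_nonneg[OF less_imp_le[OF w[OF that(1)]]
            mult_nonneg_nonneg[OF less_imp_le[OF w[OF that(2)]] less_imp_le[OF prod[OF False]]]])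
  qed (simp add: T)
  have pos: "T i j + T j i > 0"
    unfolding T mult.assoc by (rule mult_pos_pos[OF w[OF ij(1)] mult_pos_pos[OF w[OF ij(2)] prod[OF ij(3)]]])
  have "0 < (\<Sum>k\<in>I. \<Sum>l\<in>I. T k l + T l k)"
  proof (rule sum_pos2[OF fin ij(1), where f = "\<lambda>k. \<Sum>l\<in>I. T k l + T l k"])
    show "0 < (\<Sum>l\<in>I. T i l + T l i)"
      by (rule sum_pos2[OF fin ij(2), where f = "\<lambda>l. T i l + T l i", OF pos]) (use nonneg ij in auto)
    show "0 \<le> (\<Sum>l\<in>I. T k l + T l k)" if "k \<in> I" for k
      by (intro sum_nonneg nonneg that)
  qed
  also have "(\<Sum>k\<in>I. \<Sum>l\<in>I. T k l + T l k) = 2 * (\<Sum>k\<in>I. \<Sum>l\<in>I. T k l)"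
    by (simp add: sum.distrib) (rule sum.swap)
  also have "(\<Sum>k\<in>I. \<Sum>l\<in>I. T k l) = A x * B y - B x * A y"
    unfolding A_def B_def sum_product sum_subtractf[symmetric]
    by (intro sum.cong refl) (simp add: T_def algebra_simps)
  finally have "B x * A y < B y * A x" by (simp add: mult.commute)
  hence "B x / A x < B y / A y" using A by (simp add: divide_simps)
  thus ?thesis by (simp add: A_def B_def)
qed

text \<open>Monotonicity sandwiches the value at the moving point between values at two fixed
  points. This is needed because the threshold for \<open>scaled_dev\<close> is itself a tilted mean
  that varies with n.\<close>

lemma mono_tendsto_compose:
  fixes F :: "nat \<Rightarrow> real \<Rightarrow> real" and N :: "real \<Rightarrow> real"
  assumes F: "\<And>n. mono (F n)" and lim: "\<And>x. (\<lambda>n. F n x) \<longlonglongrightarrow> N x"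
    and cont: "isCont N x" and y: "y \<longlonglongrightarrow> x"
  shows "(\<lambda>n. F n (y n)) \<longlonglongrightarrow> N x"
proof (rule LIMSEQ_I)
  fix e :: real assume e: "e > 0"
  obtain d where d: "d > 0" "\<And>z. \<bar>z - x\<bar> < d \<Longrightarrow> \<bar>N z - N x\<bar> < e / 2"
    using cont e unfolding isCont_def LIM_eq
    by (metis abs_zero diff_self half_gt_zero_iff real_norm_def)
  have b: "\<bar>N (x + d / 2) - N x\<bar> < e / 2" "\<bar>N (x - d / 2) - N x\<bar> < e / 2"
    using d by auto
  have "\<forall>\<^sub>F n in sequentially. y n < x + d / 2" "\<forall>\<^sub>F n in sequentially. y n > x - d / 2"
    using order_tendstoD[OF y] d by auto
  moreover have "\<forall>\<^sub>F n in sequentially. F n (x + d / 2) < N (x + d / 2) + e / 2"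
    "\<forall>\<^sub>F n in sequentially. F n (x - d / 2) > N (x - d / 2) - e / 2"
    using order_tendstoD(2)[OF lim[of "x + d / 2"]] order_tendstoD(1)[OF lim[of "x - d / 2"]] e by auto
  ultimately have "\<forall>\<^sub>F n in sequentially. norm (F n (y n) - N x) < e"
  proof eventually_elim
    case (elim n)
    have "F n (x - d / 2) \<le> F n (y n)" "F n (y n) \<le> F n (x + d / 2)"
      using elim by (auto intro!: monoD[OF F])
    thus ?case using elim b unfolding real_norm_def by linarith
  qed
  thus "\<exists>no. \<forall>n\<ge>no. norm (F n (y n) - N x) < e" unfolding eventually_sequentially .
qed

lemma isCont_cdf_std_normal: "isCont (cdf std_normal_distribution) x"
proof -
  interpret real_distribution std_normal_distribution by (rule real_dist_normal_dist)
  have "emeasure std_normal_distribution {x} = 0"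
    by (subst emeasure_density) (auto intro!: nn_integral_null_set)
  thus ?thesis unfolding isCont_cdf by (simp add: measure_def)
qed

text \<open>The direction (b, c) is (1, 0) for the estimation of \<beta> and (0, 1) for that of h.
  The statistic is centered by its value at \<open>p\<close>, as the two-well setting
  demands.\<close>

locale four_spin_well =
  double_well "four_spin_f \<beta> h" f1 "\<lambda>a. four_spin_f b c a - four_spin_f b c p" \<phi>1 p \<kappa> K
  for \<beta> h b c f1 \<phi>1 p \<kappa> K +
  assumes bc: "0 \<le> b" "0 \<le> c" "0 < b + c"
begin

definition mean :: "nat \<Rightarrow> real \<Rightarrow> real" where
  "mean n \<theta> = (\<integral>\<eta>. four_spin_f b c (frac_plus n \<eta>) \<partial>four_spin_measure n (\<beta> + b * \<theta>) (h + c * \<theta>))"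

definition scaled_dev :: "nat \<Rightarrow> (nat \<Rightarrow> int) \<Rightarrow> real" where
  "scaled_dev n \<omega> = sqrt (real n) * (four_spin_f b c (frac_plus n \<omega>) - four_spin_f b c p)"

definition scaled_mean :: "nat \<Rightarrow> real \<Rightarrow> real" where
  "scaled_mean n t = sqrt (real n) * ((\<Sum>k\<le>n. awt n t k * (four_spin_f b c (real k / real n) - four_spin_f b c p)) / Zr n t)"

text \<open>The last factor stems from centering the statistic. It is independent of k and cancels
  in every normalized expectation.\<close>

lemma awt_eq:
  "awt n (sqrt (real n) * \<theta>) k = real (n choose k) * exp (real n * four_spin_f (\<beta> + b * \<theta>) (h + c * \<theta>) (real k / real n))
     * exp (- (real n * \<theta> * four_spin_f b c p))"
proof -
  have sq: "sqrt (real n) * \<theta> * (sqrt (real n) * y) = real n * \<theta> * y" for y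
  proof -
    have "sqrt (real n) * \<theta> * (sqrt (real n) * y) = (sqrt (real n) * sqrt (real n)) * \<theta> * y" by (simp only: ac_simps)
    thus ?thesis by simp
  qed
  have E: "real n * four_spin_f \<beta> h a + sqrt (real n) * \<theta> * (sqrt (real n) * (four_spin_f b c a - four_spin_f b c p))
      = real n * four_spin_f (\<beta> + b * \<theta>) (h + c * \<theta>) a + - (real n * \<theta> * four_spin_f b c p)" for a
    unfolding sq four_spin_f_add four_spin_f_scale by (simp add: algebra_simps)
  show ?thesis unfolding awt_def E exp_add by (simp only: mult.assoc)
qed

lemma mean_eq:
  assumes "n \<ge> 1"
  shows "sqrt (real n) * (mean n \<theta> - four_spin_f b c p) = scaled_mean n (sqrt (real n) * \<theta>)"
proof -
  define r where "r = exp (- (real n * \<theta> * four_spin_f b c p))"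
  have r: "r > 0" by (simp add: r_def)
  define G where "G = gibbs_sum n (\<beta> + b * \<theta>) (h + c * \<theta>)"
  have G: "G > 0" unfolding G_def by (rule gibbs_sum_pos)
  define S where "S = (\<Sum>k\<le>n. real (n choose k) * exp (real n * four_spin_f (\<beta> + b * \<theta>) (h + c * \<theta>) (real k / real n)) * four_spin_f b c (real k / real n))"
  have Z: "Zr n (sqrt (real n) * \<theta>) = G * r"
    unfolding Zr_def awt_eq G_def gibbs_sum_eq r_def sum_distrib_right ..
  have mean: "mean n \<theta> = S / G"
    unfolding mean_def integral_four_spin G_def S_def by (simp add: divide_inverse_commute)
  have sum: "(\<Sum>k\<le>n. awt n (sqrt (real n) * \<theta>) k * (four_spin_f b c (real k / real n) - four_spin_f b c p))
      = S * r - Zr n (sqrt (real n) * \<theta>) * four_spin_f b c p"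
    unfolding right_diff_distrib sum_subtractf Zr_def sum_distrib_right S_def awt_eq r_def
    by (simp add: ac_simps)
  show ?thesis
    unfolding scaled_mean_def sum Z mean using r G by (simp add: field_simps)
qed

lemma scaled_mean_tendsto: "(\<lambda>n. scaled_mean n t) \<longlonglongrightarrow> \<sigma>2 * t"
  unfolding scaled_mean_def by (rule tilted_mean_tendsto)

lemma scaled_mean_tilt: "scaled_mean n t = (\<Sum>k\<le>n. awt n 0 k * exp (t * (sqrt (real n) * (four_spin_f b c (real k / real n) - four_spin_f b c p)))
      * (sqrt (real n) * (four_spin_f b c (real k / real n) - four_spin_f b c p)))
   / (\<Sum>k\<le>n. awt n 0 k * exp (t * (sqrt (real n) * (four_spin_f b c (real k / real n) - four_spin_f b c p))))"
proof -
  have a: "awt n t k = awt n 0 k * exp (t * (sqrt (real n) * (four_spin_f b c (real k / real n) - four_spin_f b c p)))" for k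
    by (simp add: awt_def exp_add)
  show ?thesis unfolding scaled_mean_def Zr_def a by (simp add: sum_distrib_left ac_simps)
qed

lemma scaled_mean_strict_mono:
  assumes n: "n \<ge> 2" and "x < y"
  shows "scaled_mean n x < scaled_mean n y"
proof -
  \<comment> \<open>These are the two grid points at which the statistic differs. Their
    magnetizations are 1 - 2/n and 1; for n = 1 they would be -1 and 1, and the even statistic would
    be constant.\<close>
  have "four_spin_f b c (real (n - 1) / real n) < four_spin_f b c (real n / real n)"
  proof -
    define m where "m = 2 * (real (n - 1) / real n) - 1"
    have "m = 1 - 2 / real n" unfolding m_def using n by (simp add: of_nat_diff field_simps)
    hence m: "0 \<le> m" "m < 1" using n by auto
    have m2: "m\<^sup>2 < 1" "m ^ 4 < 1" using m by (auto simp: power_less_one_iff)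
    have "b * m ^ 4 + c * m\<^sup>2 < b + c"
    proof (cases "b = 0")
      case True thus ?thesis using bc m2 by simp
    next
      case False
      hence "b * m ^ 4 < b * 1" using bc m2 by (intro mult_strict_left_mono) auto
      moreover have "c * m\<^sup>2 \<le> c * 1" using bc m2 by (intro mult_left_mono) auto
      ultimately show ?thesis by simp
    qed
    thus ?thesis using n unfolding four_spin_f_def m_def[symmetric] by simp
  qed
  hence "sqrt (real n) * (four_spin_f b c (real (n - 1) / real n) - four_spin_f b c p)
      \<noteq> sqrt (real n) * (four_spin_f b c (real n / real n) - four_spin_f b c p)"
    using n by simp
  moreover have "awt n 0 k > 0" if "k \<in> {..n}" for k using that by (simp add: awt_def)
  ultimately show ?thesis
    unfolding scaled_mean_tilt using assms by (intro tilted_mean_strict_mono[of _ _ "n - 1" n]) auto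
qed

lemma scaled_mean_continuous: "continuous_on S (scaled_mean n)"
proof -
  have "(\<Sum>k\<le>n. awt n 0 k * exp (t * (sqrt (real n) * (four_spin_f b c (real k / real n) - four_spin_f b c p)))) \<noteq> 0" for t
  proof -
    have "0 < (\<Sum>k\<le>n. awt n 0 k * exp (t * (sqrt (real n) * (four_spin_f b c (real k / real n) - four_spin_f b c p))))"
      by (intro sum_pos) (auto simp: awt_def)
    thus ?thesis by simp
  qed
  thus ?thesis unfolding scaled_mean_tilt[abs_def] by (intro continuous_intros) auto
qed

lemma char_scaled_dev: "char (distr (four_spin_measure n \<beta> h) borel (\<lambda>\<omega>. scaled_dev n \<omega> / sqrt \<sigma>2)) s
   = (\<Sum>k\<le>n. wt n (\<i> * of_real (s / sqrt \<sigma>2)) k) / of_real (Zr n 0)"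
proof -
  have Z: "gibbs_sum n \<beta> h = Zr n 0" by (simp add: gibbs_sum_eq Zr_def awt_def)
  have "char (distr (four_spin_measure n \<beta> h) borel (\<lambda>\<omega>. scaled_dev n \<omega> / sqrt \<sigma>2)) s
     = (\<integral>\<eta>. iexp (s * (sqrt (real n) * (four_spin_f b c (frac_plus n \<eta>) - four_spin_f b c p) / sqrt \<sigma>2)) \<partial>four_spin_measure n \<beta> h)"
    unfolding char_def scaled_dev_def by (subst integral_distr) auto
  also have "\<dots> = (\<Sum>k\<le>n. wt n (\<i> * of_real (s / sqrt \<sigma>2)) k) /\<^sub>R gibbs_sum n \<beta> h"
  proof -
    have "wt n (\<i> * of_real (s / sqrt \<sigma>2)) k = of_nat (n choose k) * of_real (exp (real n * four_spin_f \<beta> h (real k / real n)))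
        * iexp (s * (sqrt (real n) * (four_spin_f b c (real k / real n) - four_spin_f b c p) / sqrt \<sigma>2))" for k
      unfolding wt_def exp_add by (simp add: mult_ac flip: exp_of_real)
    thus ?thesis
      by (simp only: integral_four_spin[where G = "\<lambda>a. iexp (s * (sqrt (real n) * (four_spin_f b c a - four_spin_f b c p) / sqrt \<sigma>2))"])
  qed
  finally show ?thesis by (simp add: Z scaleR_conv_of_real divide_inverse mult.commute)
qed

lemma weak_conv_scaled_dev:
  "weak_conv_m (\<lambda>n. distr (four_spin_measure n \<beta> h) borel (\<lambda>\<omega>. scaled_dev n \<omega> / sqrt \<sigma>2)) std_normal_distribution"
proof (rule levy_continuity)
  fix n
  interpret prob_space "four_spin_measure n \<beta> h" by (rule prob_space_four_spin)
  show "real_distribution (distr (four_spin_measure n \<beta> h) borel (\<lambda>\<omega>. scaled_dev n \<omega> / sqrt \<sigma>2))"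
    by (rule real_distribution_distr) auto
next
  show "real_distribution std_normal_distribution" by (rule real_dist_normal_dist)
next
  fix s
  have "\<sigma>2 * (s / sqrt \<sigma>2)\<^sup>2 / 2 = s\<^sup>2 / 2" using \<sigma>2_pos by (simp add: power_divide)
  thus "(\<lambda>n. char (distr (four_spin_measure n \<beta> h) borel (\<lambda>\<omega>. scaled_dev n \<omega> / sqrt \<sigma>2)) s) \<longlonglongrightarrow> char std_normal_distribution s"
    unfolding char_scaled_dev char_std_normal_distribution using char_tendsto[of "s / sqrt \<sigma>2"] by simp
qed

lemma prob_scaled_dev_tendsto:
  assumes "y \<longlonglongrightarrow> x"
  shows "(\<lambda>n. measure (four_spin_measure n \<beta> h) {\<omega> \<in> spins n. scaled_dev n \<omega> \<le> y n}) \<longlonglongrightarrow> cdf std_normal_distribution (x / sqrt \<sigma>2)"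
proof -
  define F where "F = (\<lambda>n. cdf (distr (four_spin_measure n \<beta> h) borel (\<lambda>\<omega>. scaled_dev n \<omega> / sqrt \<sigma>2)))"
  have "(\<lambda>n. F n (y n / sqrt \<sigma>2)) \<longlonglongrightarrow> cdf std_normal_distribution (x / sqrt \<sigma>2)"
  proof (rule mono_tendsto_compose[where F = F and N = "cdf std_normal_distribution" and x = "x / sqrt \<sigma>2" and y = "\<lambda>n. y n / sqrt \<sigma>2"])
    fix n
    interpret prob_space "four_spin_measure n \<beta> h" by (rule prob_space_four_spin)
    interpret D: real_distribution "distr (four_spin_measure n \<beta> h) borel (\<lambda>\<omega>. scaled_dev n \<omega> / sqrt \<sigma>2)"
      by (rule real_distribution_distr) auto
    show "mono (F n)" unfolding F_def by (intro monoI D.cdf_nondecreasing)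
  next
    show "(\<lambda>n. F n x) \<longlonglongrightarrow> cdf std_normal_distribution x" for x
      using weak_conv_scaled_dev isCont_cdf_std_normal unfolding weak_conv_m_def weak_conv_def F_def by blast
  qed (use assms \<sigma>2_pos in \<open>auto intro!: tendsto_divide isCont_cdf_std_normal\<close>)
  moreover have "F n (y n / sqrt \<sigma>2) = measure (four_spin_measure n \<beta> h) {\<omega> \<in> spins n. scaled_dev n \<omega> \<le> y n}" for n
  proof -
    have "(\<lambda>\<omega>. scaled_dev n \<omega> / sqrt \<sigma>2) -` {..y n / sqrt \<sigma>2} \<inter> spins n = {\<omega> \<in> spins n. scaled_dev n \<omega> \<le> y n}"
      using \<sigma>2_pos by (auto simp: divide_le_cancel)
    thus ?thesis unfolding F_def cdf_def by (subst measure_distr) auto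
  qed
  ultimately show ?thesis by simp
qed

text \<open>Where the deviation lies between the tilted means at -T and T, the events for the
  estimator and for the deviation coincide. The remaining samples, on which the estimator may be
  arbitrary, have a probability controlled by normal tails.\<close>

lemma estimator_cdf_tendsto:
  assumes est: "\<And>n \<omega>. \<omega> \<in> spins n \<Longrightarrow> \<exists>!\<theta>. mean n \<theta> = four_spin_f b c (frac_plus n \<omega>)
      \<Longrightarrow> mean n (est n \<omega>) = four_spin_f b c (frac_plus n \<omega>)"
  shows "(\<lambda>n. measure (four_spin_measure n \<beta> h) {\<omega> \<in> spins n. sqrt (real n) * est n \<omega> \<le> t})
    \<longlonglongrightarrow> cdf std_normal_distribution (sqrt \<sigma>2 * t)"
proof -
  define N where "N = cdf std_normal_distribution"
  interpret N: real_distribution std_normal_distribution by (rule real_dist_normal_dist)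
  define F where "F = (\<lambda>n. measure (four_spin_measure n \<beta> h) {\<omega> \<in> spins n. sqrt (real n) * est n \<omega> \<le> t})"
  define P where "P = (\<lambda>n y. measure (four_spin_measure n \<beta> h) {\<omega> \<in> spins n. scaled_dev n \<omega> \<le> y})"
  have \<sigma>: "\<sigma>2 * x / sqrt \<sigma>2 = sqrt \<sigma>2 * x" for x
    using \<sigma>2_pos by (simp add: field_simps)
  have P: "(\<lambda>n. P n (scaled_mean n x)) \<longlonglongrightarrow> N (sqrt \<sigma>2 * x)" for x
    using prob_scaled_dev_tendsto[OF scaled_mean_tendsto[of x]] unfolding \<sigma> P_def N_def .
  \<comment> \<open>The intermediate value theorem on \<open>[-T, T]\<close> yields the solution of the moment equation, so no
    analysis of the equation at infinity is needed.\<close>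
  have compare: "\<bar>F n - P n (scaled_mean n t)\<bar> \<le> P n (scaled_mean n (- T)) + (1 - P n (scaled_mean n T))"
    if n: "n \<ge> 2" and T: "T > 0" for n T
  proof -
    interpret prob_space "four_spin_measure n \<beta> h" by (rule prob_space_four_spin)
    have sn: "sqrt (real n) > 0" using n by simp
    have mean_iff: "mean n \<theta> = four_spin_f b c (frac_plus n \<omega>) \<longleftrightarrow> scaled_mean n (sqrt (real n) * \<theta>) = scaled_dev n \<omega>" for \<theta> \<omega>
      using mean_eq[of n \<theta>] n sn unfolding scaled_dev_def by auto
    have scaled_mean_inj: "x = y" if "scaled_mean n x = scaled_mean n y" for x y
      using that scaled_mean_strict_mono[OF n, of x y] scaled_mean_strict_mono[OF n, of y x] by (cases x y rule: linorder_cases) auto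
    have scaled_mean_le: "scaled_mean n x \<le> scaled_mean n y \<longleftrightarrow> x \<le> y" for x y
      using scaled_mean_strict_mono[OF n, of x y] scaled_mean_strict_mono[OF n, of y x] by (cases x y rule: linorder_cases) auto
    have good: "sqrt (real n) * est n \<omega> \<le> t \<longleftrightarrow> scaled_dev n \<omega> \<le> scaled_mean n t"
      if \<omega>: "\<omega> \<in> spins n" "scaled_mean n (- T) \<le> scaled_dev n \<omega>" "scaled_dev n \<omega> \<le> scaled_mean n T" for \<omega>
    proof -
      obtain x where x: "scaled_mean n x = scaled_dev n \<omega>"
        using IVT'[of "scaled_mean n" "- T" "scaled_dev n \<omega>" T] \<omega> T scaled_mean_continuous by auto
      have "\<exists>!\<theta>. scaled_mean n (sqrt (real n) * \<theta>) = scaled_dev n \<omega>"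
      proof (rule ex1I[of _ "x / sqrt (real n)"])
        show "scaled_mean n (sqrt (real n) * (x / sqrt (real n))) = scaled_dev n \<omega>" using sn x by simp
        show "\<theta> = x / sqrt (real n)" if "scaled_mean n (sqrt (real n) * \<theta>) = scaled_dev n \<omega>" for \<theta>
          using scaled_mean_inj[of "sqrt (real n) * \<theta>" x] that x sn by (simp add: field_simps)
      qed
      hence "scaled_mean n (sqrt (real n) * est n \<omega>) = scaled_dev n \<omega>"
        using est[OF \<omega>(1)] unfolding mean_iff by simp
      thus ?thesis using scaled_mean_le by metis
    qed
    define L where "L = {\<omega> \<in> spins n. scaled_dev n \<omega> \<le> scaled_mean n (- T)}"
    define U where "U = {\<omega> \<in> spins n. scaled_dev n \<omega> > scaled_mean n T}"
    define A where "A = {\<omega> \<in> spins n. sqrt (real n) * est n \<omega> \<le> t}"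
    define B where "B = {\<omega> \<in> spins n. scaled_dev n \<omega> \<le> scaled_mean n t}"
    have ev: "L \<in> events" "U \<in> events" "A \<in> events" "B \<in> events"
      by (auto simp: L_def U_def A_def B_def)
    have "U = space (four_spin_measure n \<beta> h) - {\<omega> \<in> spins n. scaled_dev n \<omega> \<le> scaled_mean n T}"
      by (auto simp: U_def)
    hence PU: "prob U = 1 - P n (scaled_mean n T)"
      unfolding P_def by (simp only:) (rule prob_compl, simp)
    have sub: "A \<subseteq> B \<union> (L \<union> U)" "B \<subseteq> A \<union> (L \<union> U)"
    proof -
      have "\<omega> \<in> L \<union> U \<or> (\<omega> \<in> A \<longleftrightarrow> \<omega> \<in> B)" if "\<omega> \<in> spins n" for \<omega>
        using good[OF that] that unfolding L_def U_def A_def B_def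
        by (cases "scaled_dev n \<omega> \<le> scaled_mean n (- T)"; cases "scaled_mean n T < scaled_dev n \<omega>") simp_all
      moreover have "A \<subseteq> spins n" "B \<subseteq> spins n" by (auto simp: A_def B_def)
      ultimately show "A \<subseteq> B \<union> (L \<union> U)" "B \<subseteq> A \<union> (L \<union> U)" by blast+
    qed
    have "prob A \<le> prob (B \<union> (L \<union> U))" "prob B \<le> prob (A \<union> (L \<union> U))"
      using sub ev by (auto intro!: finite_measure_mono)
    moreover have "prob (B \<union> (L \<union> U)) \<le> prob B + prob (L \<union> U)" "prob (A \<union> (L \<union> U)) \<le> prob A + prob (L \<union> U)"
      "prob (L \<union> U) \<le> prob L + prob U"
      using ev by (auto intro!: measure_Un_le)
    ultimately have "\<bar>prob A - prob B\<bar> \<le> prob L + prob U" by linarith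
    thus ?thesis unfolding PU by (simp add: A_def B_def F_def P_def L_def)
  qed
  define r where "r = sqrt \<sigma>2"
  have "r > 0" using \<sigma>2_pos by (simp add: r_def)
  hence "filterlim (\<lambda>T. r * (- T)) at_bot at_top" "filterlim (\<lambda>T. r * T) at_top at_top" by real_asymp+
  note lim = this[unfolded r_def]
  have "F \<longlonglongrightarrow> N (sqrt \<sigma>2 * t)"
  proof (rule LIMSEQ_I)
    fix \<epsilon> :: real assume \<epsilon>: "\<epsilon> > 0"
    have "((\<lambda>T. N (sqrt \<sigma>2 * (- T)) + (1 - N (sqrt \<sigma>2 * T))) \<longlongrightarrow> 0 + (1 - 1)) at_top"
      unfolding N_def
    proof (intro tendsto_intros)
      show "((\<lambda>T. cdf std_normal_distribution (sqrt \<sigma>2 * (- T))) \<longlongrightarrow> 0) at_top"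
        by (rule filterlim_compose[OF N.cdf_lim_at_bot lim(1)])
      show "((\<lambda>T. cdf std_normal_distribution (sqrt \<sigma>2 * T)) \<longlongrightarrow> 1) at_top"
        by (rule filterlim_compose[OF N.cdf_lim_at_top_prob lim(2)])
    qed
    \<comment> \<open>The order of choices matters: T is fixed from the limiting tails, and only
      then is n taken large. The other half of \<open>\<epsilon>\<close> pays for the convergence at
      t.\<close>
    hence "\<forall>\<^sub>F T in at_top. N (sqrt \<sigma>2 * (- T)) + (1 - N (sqrt \<sigma>2 * T)) < \<epsilon> / 2"
      by (rule order_tendstoD(2)) (use \<epsilon> in simp)
    hence "\<forall>\<^sub>F T in at_top. N (sqrt \<sigma>2 * (- T)) + (1 - N (sqrt \<sigma>2 * T)) < \<epsilon> / 2 \<and> T > 0"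
      using eventually_gt_at_top[of 0] by eventually_elim simp
    then obtain T where T: "N (sqrt \<sigma>2 * (- T)) + (1 - N (sqrt \<sigma>2 * T)) < \<epsilon> / 2" "T > 0"
      using eventually_happens[of _ "at_top :: real filter"] by auto
    have "(\<lambda>n. P n (scaled_mean n (- T)) + (1 - P n (scaled_mean n T))) \<longlonglongrightarrow> N (sqrt \<sigma>2 * (- T)) + (1 - N (sqrt \<sigma>2 * T))"
      by (intro tendsto_intros P)
    hence "\<forall>\<^sub>F n in sequentially. P n (scaled_mean n (- T)) + (1 - P n (scaled_mean n T)) < \<epsilon> / 2"
      using T(1) by (rule order_tendstoD(2))
    moreover have "\<forall>\<^sub>F n in sequentially. dist (P n (scaled_mean n t)) (N (sqrt \<sigma>2 * t)) < \<epsilon> / 2"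
      using P[of t] \<epsilon> by (intro tendstoD) auto
    ultimately have "\<forall>\<^sub>F n in sequentially. norm (F n - N (sqrt \<sigma>2 * t)) < \<epsilon>"
      using eventually_ge_at_top[of 2]
    proof eventually_elim
      case (elim n)
      thus ?case using compare[OF elim(3) T(2)] unfolding dist_real_def real_norm_def by linarith
    qed
    thus "\<exists>no. \<forall>n\<ge>no. norm (F n - N (sqrt \<sigma>2 * t)) < \<epsilon>" unfolding eventually_sequentially .
  qed
  thus ?thesis unfolding F_def N_def .
qed

end

section \<open>The centered normal law as a half-normal mixture\<close>

lemma
  assumes "0 < v"
  shows emeasure_centered_normal_uminus: "B \<in> sets borel \<Longrightarrow> emeasure (centered_normal v) {z. - z \<in> B} = emeasure (centered_normal v) B"
    and measure_centered_normal_atMost: "measure (centered_normal v) {..t} = cdf std_normal_distribution (t / sqrt v)"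
proof -
  \<comment> \<open>Scaling by -1 gives the symmetry, scaling by \<open>sqrt v\<close> the reduction
    to the standard normal law.\<close>
  have affine: "distr (centered_normal u) lborel (\<lambda>x. \<alpha> * x) = centered_normal (\<alpha>\<^sup>2 * u)"
    if "0 < u" "\<alpha> \<noteq> 0" for u \<alpha> :: real
  proof -
    interpret prob_space "centered_normal u"
      unfolding centered_normal_def using that by (intro prob_space_normal_density) simp
    have "distr (centered_normal u) lborel (\<lambda>x. x) = centered_normal u"
      by (rule distr_id2) (simp add: centered_normal_def)
    hence "distributed (centered_normal u) lborel (\<lambda>x. x) (normal_density 0 (sqrt u))"
      unfolding distributed_def by (simp add: centered_normal_def)
    from normal_density_affine[OF this, of \<alpha> 0] that
    have "distributed (centered_normal u) lborel (\<lambda>x. \<alpha> * x) (normal_density 0 (\<bar>\<alpha>\<bar> * sqrt u))" by simp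
    hence "distr (centered_normal u) lborel (\<lambda>x. \<alpha> * x) = density lborel (normal_density 0 (\<bar>\<alpha>\<bar> * sqrt u))"
      by (rule distributed_distr_eq_density)
    thus ?thesis by (simp add: centered_normal_def real_sqrt_mult)
  qed
  have meas: "(\<lambda>x. \<alpha> * x) \<in> measurable (centered_normal u) lborel" for \<alpha> u :: real
    unfolding centered_normal_def by simp
  have space: "space (centered_normal u) = UNIV" for u by (simp add: centered_normal_def)
  show "emeasure (centered_normal v) {z. - z \<in> B} = emeasure (centered_normal v) B" if "B \<in> sets borel"
    using emeasure_distr[OF meas[of "-1" v], of B] affine[OF assms, of "-1"] that
    by (simp add: space vimage_def)
  have "measure (centered_normal v) {..t} = measure (distr (centered_normal 1) lborel (\<lambda>x. sqrt v * x)) {..t}"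
    using affine[of 1 "sqrt v"] assms by simp
  also have "\<dots> = measure (centered_normal 1) {..t / sqrt v}"
  proof -
    have "(\<lambda>x. sqrt v * x) -` {..t} = {..t / sqrt v}"
      using assms by (auto simp: field_simps)
    thus ?thesis using measure_distr[OF meas[of "sqrt v" 1], of "{..t}"] by (simp add: space)
  qed
  finally show "measure (centered_normal v) {..t} = cdf std_normal_distribution (t / sqrt v)"
    by (simp add: cdf_def centered_normal_def)
qed

text \<open>The unordered pairs formed by \<bar>z\<bar>, -\<bar>z\<bar> and by z, -z agree, so the
  two half-normal measures add up to the normal law plus its reflection, that is, to twice the
  normal law. The atom at 0 receives weight 0.\<close>

lemma emeasure_half_normal_mixture_half:
  assumes v: "0 < v" and B: "B \<in> sets borel"
  shows "emeasure (half_normal_mixture (1/2) v (1/2) v) B = emeasure (centered_normal v) B"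
proof -
  let ?N = "centered_normal v"
  have sets: "sets ?N = sets borel" by (simp add: centered_normal_def)
  have space: "space ?N = UNIV" by (simp add: centered_normal_def)
  have [measurable]: "B \<in> sets borel" by fact
  have m: "{z. - \<bar>z\<bar> \<in> B} \<in> sets ?N" "{z. \<bar>z\<bar> \<in> B} \<in> sets ?N" "{z. - z \<in> B} \<in> sets ?N" "B \<in> sets ?N"
    unfolding sets by measurable
  have neg: "emeasure (half_normal_neg v) B = emeasure ?N {z. - \<bar>z\<bar> \<in> B}"
    unfolding half_normal_neg_def using B
    by (subst emeasure_distr) (auto simp: vimage_def space measurable_cong_sets[OF sets refl])
  have pos: "emeasure (half_normal_pos v) B = emeasure ?N {z. \<bar>z\<bar> \<in> B}"
    unfolding half_normal_pos_def using B
    by (subst emeasure_distr) (auto simp: vimage_def space measurable_cong_sets[OF sets refl])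
  have "emeasure ?N {z. - \<bar>z\<bar> \<in> B} + emeasure ?N {z. \<bar>z\<bar> \<in> B}
      = (\<integral>\<^sup>+z. indicator {z. - \<bar>z\<bar> \<in> B} z + indicator {z. \<bar>z\<bar> \<in> B} z \<partial>?N)"
    using m by (subst nn_integral_add) auto
  also have "\<dots> = (\<integral>\<^sup>+z. indicator {z. - z \<in> B} z + indicator B z \<partial>?N)"
    by (intro nn_integral_cong) (auto simp: indicator_def abs_if)
  also have "\<dots> = emeasure ?N {z. - z \<in> B} + emeasure ?N B"
    using m by (subst nn_integral_add) auto
  finally have sum: "emeasure ?N {z. - \<bar>z\<bar> \<in> B} + emeasure ?N {z. \<bar>z\<bar> \<in> B} = emeasure ?N B + emeasure ?N B"
    unfolding emeasure_centered_normal_uminus[OF v B] .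
  have "emeasure (half_normal_mixture (1/2) v (1/2) v) B
      = ennreal (1/2) * (emeasure ?N {z. - \<bar>z\<bar> \<in> B} + emeasure ?N {z. \<bar>z\<bar> \<in> B})"
    unfolding emeasure_half_normal_mixture[OF B] neg pos by (simp add: distrib_left)
  also have "\<dots> = (ennreal (1/2) + ennreal (1/2)) * emeasure ?N B"
    unfolding sum by (simp only: distrib_left distrib_right)
  also have "ennreal (1/2) + ennreal (1/2) = 1"
    by (subst ennreal_plus[symmetric]) simp_all
  finally show ?thesis by simp
qed

section \<open>Checking the two-well hypotheses for the free energy\<close>

lemma bounded_on_unit_interval:
  fixes g :: "real \<Rightarrow> real"
  assumes "continuous_on UNIV g"
  obtains K where "0 \<le> K" "\<And>a. a \<in> {0..1} \<Longrightarrow> \<bar>g a\<bar> \<le> K"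
proof -
  have "bounded (g ` {0..1})"
    using assms by (intro compact_imp_bounded compact_continuous_image) (auto intro: continuous_on_subset)
  then obtain K where K: "\<forall>a\<in>{0..1}. \<bar>g a\<bar> \<le> K" by (auto simp: bounded_iff)
  show ?thesis
  proof (rule that)
    show "0 \<le> K" using order.trans[OF abs_ge_zero, of "g 0" K] K by simp
  qed (use K in auto)
qed

lemma taylor_unit_interval:
  fixes g g1 g2 :: "real \<Rightarrow> real"
  assumes g: "\<And>x. (g has_real_derivative g1 x) (at x)" and g1: "\<And>x. (g1 has_real_derivative g2 x) (at x)"
    and "continuous_on UNIV g2"
  obtains K where "0 \<le> K"
    "\<And>a b. a \<in> {0..1} \<Longrightarrow> b \<in> {0..1} \<Longrightarrow> \<bar>g b - g a - (b - a) * g1 a\<bar> \<le> K * (b - a)\<^sup>2"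
    "\<And>a b. a \<in> {0..1} \<Longrightarrow> b \<in> {0..1} \<Longrightarrow> \<bar>g1 b - g1 a\<bar> \<le> K * \<bar>b - a\<bar>"
proof -
  obtain K where K: "0 \<le> K" and g2: "\<And>a. a \<in> {0..1} \<Longrightarrow> \<bar>g2 a\<bar> \<le> K"
    by (rule bounded_on_unit_interval[OF assms(3)]) auto
  show ?thesis
  proof (rule that[OF K])
    fix a b :: real assume ab: "a \<in> {0..1}" "b \<in> {0..1}"
    show "\<bar>g b - g a - (b - a) * g1 a\<bar> \<le> K * (b - a)\<^sup>2"
    proof (cases "a = b")
      case False
      define d where "d = (\<lambda>m::nat. if m = 0 then g else if m = 1 then g1 else g2)"
      have "\<forall>m t. m < 2 \<and> 0 \<le> t \<and> t \<le> 1 \<longrightarrow> (d m has_real_derivative d (Suc m) t) (at t)"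
        using g g1 by (auto simp: d_def less_2_cases_iff)
      then obtain t where t: "if b < a then b < t \<and> t < a else a < t \<and> t < b"
        "g b = (\<Sum>m<2. d m a / fact m * (b - a) ^ m) + d 2 t / fact 2 * (b - a) ^ 2"
        using Taylor[of 2 d g 0 1 a b] ab False by (auto simp: d_def)
      have "t \<in> {0..1}" using t(1) ab by (auto split: if_splits)
      hence "\<bar>g2 t / 2\<bar> \<le> K" using g2[of t] by auto
      hence "\<bar>g2 t / 2\<bar> * (b - a)\<^sup>2 \<le> K * (b - a)\<^sup>2" by (rule mult_right_mono) simp
      moreover have "g b - g a - (b - a) * g1 a = g2 t / 2 * (b - a)\<^sup>2"
        using t(2) by (simp add: d_def numeral_2_eq_2)
      ultimately show ?thesis by (simp only: abs_mult abs_power2)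
    qed simp
    have "norm (g1 b - g1 a) \<le> K * norm (b - a)"
      by (rule field_differentiable_bound[of "{0..1}" g1 g2])
        (use g1 g2 ab in \<open>auto intro: has_field_derivative_at_within\<close>)
    thus "\<bar>g1 b - g1 a\<bar> \<le> K * \<bar>b - a\<bar>" by simp
  qed
qed

lemma continuous_on_entropy_fn: "continuous_on {0..1} entropy_fn"
proof -
  have x: "continuous_on {0..} (\<lambda>x::real. x * ln x)"
    unfolding continuous_on_eq_continuous_within
  proof
    fix x :: real assume "x \<in> {0..}"
    show "continuous (at x within {0..}) (\<lambda>x. x * ln x)"
    proof (cases "x = 0")
      case True
      have "((\<lambda>x::real. x * ln x) \<longlongrightarrow> 0) (at_right 0)" by real_asymp
      thus ?thesis unfolding True by (simp add: continuous_within at_within_Ici_at_right)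
    next
      case False
      thus ?thesis using \<open>x \<in> {0..}\<close> by (intro continuous_intros) auto
    qed
  qed
  have "continuous_on {0..1} (\<lambda>a::real. (1 - a) * ln (1 - a))"
    by (rule continuous_on_compose2[OF x, of "{0..1}" "\<lambda>a. 1 - a"]) (auto intro!: continuous_intros)
  moreover have "continuous_on {0..1} (\<lambda>a::real. a * ln a)"
    by (rule continuous_on_subset[OF x]) auto
  ultimately have "continuous_on {0..1} (\<lambda>a::real. - (a * ln a) - (1 - a) * ln (1 - a))"
    by (intro continuous_on_diff continuous_on_minus)
  thus ?thesis unfolding entropy_fn_def[abs_def] by simp
qed

lemma four_spin_f_derivs:
  shows "(four_spin_f b c has_real_derivative 8 * b * (2 * a - 1) ^ 3 + 4 * c * (2 * a - 1)) (at a)"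
    and "((\<lambda>a. 8 * b * (2 * a - 1) ^ 3 + 4 * c * (2 * a - 1)) has_real_derivative 48 * b * (2 * a - 1)\<^sup>2 + 8 * c) (at a)"
    and "((\<lambda>a. 48 * b * (2 * a - 1)\<^sup>2 + 8 * c) has_real_derivative 192 * b * (2 * a - 1)) (at a)"
  unfolding four_spin_f_def[abs_def]
  by (auto intro!: derivative_eq_intros simp: power2_eq_square power3_eq_cube)

lemma entropy_fn_reflect: "entropy_fn (1 - a) = entropy_fn a"
  by (simp add: entropy_fn_def algebra_simps)

lemma maximizers_iff:
  "a \<in> maximizers \<beta> h \<longleftrightarrow> a \<in> {0..1} \<and> (\<forall>y\<in>{0..1}. free_energy \<beta> h y \<le> free_energy \<beta> h a)"
  unfolding maximizers_def is_arg_max_linorder by auto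

lemma free_energy_deriv:
  assumes "0 < a" "a < 1"
  shows "(free_energy \<beta> h has_real_derivative 8 * \<beta> * (2 * a - 1) ^ 3 + 4 * h * (2 * a - 1) + (ln (1 - a) - ln a)) (at a)"
proof -
  have "(entropy_fn has_real_derivative ln (1 - a) - ln a) (at a)"
    unfolding entropy_fn_def[abs_def] using assms by (auto intro!: derivative_eq_intros)
  from DERIV_add[OF four_spin_f_derivs(1) this] show ?thesis unfolding free_energy_def[abs_def] .
qed

lemma free_energy_deriv2:
  assumes "0 < a" "a < 1"
  shows "deriv (deriv (free_energy \<beta> h)) a = 48 * \<beta> * (2 * a - 1)\<^sup>2 + 8 * h - 1 / (1 - a) - 1 / a"
proof (rule DERIV_imp_deriv)
  let ?D = "\<lambda>a. 8 * \<beta> * (2 * a - 1) ^ 3 + 4 * h * (2 * a - 1) + (ln (1 - a) - ln a)"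
  have "((\<lambda>a. ln (1 - a) - ln a) has_real_derivative - 1 / (1 - a) - 1 / a) (at a)"
    using assms by (auto intro!: derivative_eq_intros)
  from DERIV_add[OF four_spin_f_derivs(2)[of \<beta> h a] this]
  have D: "(?D has_real_derivative 48 * \<beta> * (2 * a - 1)\<^sup>2 + 8 * h - 1 / (1 - a) - 1 / a) (at a)"
    by (simp add: algebra_simps)
  have "\<forall>\<^sub>F x in nhds a. x \<in> {0<..<1}" by (rule eventually_nhds_in_open) (use assms in auto)
  hence "\<forall>\<^sub>F x in nhds a. deriv (free_energy \<beta> h) x = ?D x"
    by eventually_elim (auto intro!: DERIV_imp_deriv free_energy_deriv)
  from DERIV_cong_ev[OF refl this refl] D
  show "(deriv (free_energy \<beta> h) has_real_derivative 48 * \<beta> * (2 * a - 1)\<^sup>2 + 8 * h - 1 / (1 - a) - 1 / a) (at a)"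
    by blast
qed

text \<open>The derivative of the free energy is singular at 0 and 1, whereas \<open>D\<close> below
  is smooth on the whole line: the logarithms disappear on exponentiation. Hence Taylor's formula at
  \<open>p\<close> gives a uniform \<open>drift\<close> bound up to the endpoints.\<close>

lemma four_spin_well_of_maximizers:
  assumes max: "maximizers \<beta> h = {am, p}" and p: "1 / 2 < p" "p < 1" and am: "am < 1 / 2"
    and conc: "deriv (deriv (free_energy \<beta> h)) p < 0" and bc: "0 \<le> b" "0 \<le> c" "0 < b + c"
  obtains \<kappa> K where "four_spin_well \<beta> h b c (\<lambda>a. 8 * \<beta> * (2 * a - 1) ^ 3 + 4 * h * (2 * a - 1))
     (\<lambda>a. 8 * b * (2 * a - 1) ^ 3 + 4 * c * (2 * a - 1)) p \<kappa> K"
proof -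
  define f where "f = four_spin_f \<beta> h"
  define f1 where "f1 = (\<lambda>a. 8 * \<beta> * (2 * a - 1) ^ 3 + 4 * h * (2 * a - 1))"
  define f2 where "f2 = (\<lambda>a. 48 * \<beta> * (2 * a - 1)\<^sup>2 + 8 * h)"
  define f3 where "f3 = (\<lambda>a. 192 * \<beta> * (2 * a - 1))"
  define \<phi> where "\<phi> = (\<lambda>a. four_spin_f b c a - four_spin_f b c p)"
  define \<phi>1 where "\<phi>1 = (\<lambda>a. 8 * b * (2 * a - 1) ^ 3 + 4 * c * (2 * a - 1))"
  define \<phi>2 where "\<phi>2 = (\<lambda>a. 48 * b * (2 * a - 1)\<^sup>2 + 8 * c)"
  have f: "(f has_real_derivative f1 x) (at x)" "(f1 has_real_derivative f2 x) (at x)" "(f2 has_real_derivative f3 x) (at x)" for x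
    unfolding f_def f1_def f2_def f3_def by (fact four_spin_f_derivs)+
  have \<phi>: "(\<phi> has_real_derivative \<phi>1 x) (at x)" "(\<phi>1 has_real_derivative \<phi>2 x) (at x)" for x
    using DERIV_diff[OF four_spin_f_derivs(1)[of b c x] DERIV_const[of "four_spin_f b c p"]] four_spin_f_derivs(2)
    unfolding \<phi>_def \<phi>1_def \<phi>2_def by simp_all
  have cont: "continuous_on UNIV f1" "continuous_on UNIV f2" "continuous_on UNIV f3"
     "continuous_on UNIV \<phi>" "continuous_on UNIV \<phi>1" "continuous_on UNIV \<phi>2"
    unfolding f1_def f2_def f3_def \<phi>_def \<phi>1_def \<phi>2_def four_spin_f_def by (intro continuous_intros)+
  define D where "D = (\<lambda>a. (1 - a) * exp (f1 a) - a)"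
  define D1 where "D1 = (\<lambda>a. (1 - a) * f2 a * exp (f1 a) - exp (f1 a) - 1)"
  define D2 where "D2 = (\<lambda>a. (1 - a) * (f3 a + (f2 a)\<^sup>2) * exp (f1 a) - 2 * f2 a * exp (f1 a))"
  have D: "(D has_real_derivative D1 x) (at x)" "(D1 has_real_derivative D2 x) (at x)" for x
    unfolding D_def D1_def D2_def
    by (auto intro!: derivative_eq_intros f simp: algebra_simps power2_eq_square)
  have D2: "continuous_on UNIV D2" unfolding D2_def by (intro continuous_intros cont)
  have pmax: "free_energy \<beta> h y \<le> free_energy \<beta> h p" if "y \<in> {0..1}" for y
    using max that maximizers_iff[of p \<beta> h] by auto
  have sym: "free_energy \<beta> h (1 - a) = free_energy \<beta> h a" for a
    by (simp add: free_energy_def four_spin_f_reflect entropy_fn_reflect)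
  have "1 - p \<in> maximizers \<beta> h"
    unfolding maximizers_iff sym using p pmax by auto
  \<comment> \<open>The reflection of \<open>p\<close> is a maximizer below 1/2, and only one such
    maximizer is available.\<close>
  hence am_eq: "am = 1 - p" using max p by auto
  have "f1 p + (ln (1 - p) - ln p) = 0"
    using free_energy_deriv[of p \<beta> h] p unfolding f1_def
    by (intro DERIV_local_max[of "free_energy \<beta> h" _ p "min p (1 - p)"]) (auto intro!: pmax)
  hence "f1 p = ln p - ln (1 - p)" by simp
  hence exp_f1: "exp (f1 p) = p / (1 - p)" using p by (simp add: exp_diff)
  \<comment> \<open>Criticality makes \<open>exp (f1 p)\<close> the odds p/(1 - p); the slope of
    \<open>D\<close> at \<open>p\<close> thereby becomes a positive multiple of the second
    derivative.\<close>
  have D1p: "D1 p = p * deriv (deriv (free_energy \<beta> h)) p"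
  proof -
    have "D1 p = p * (f2 p - 1 / (1 - p) - 1 / p)"
      unfolding D1_def exp_f1 using p by (simp add: right_diff_distrib)
    thus ?thesis using free_energy_deriv2[of p \<beta> h] p by (simp add: f2_def)
  qed
  have \<kappa>: "D1 p < 0" unfolding D1p using p conc by (intro mult_pos_neg) auto
  have Dp: "D p = 0" unfolding D_def exp_f1 using p by simp
  obtain K1 where K1: "0 \<le> K1" "\<And>a b. a \<in> {0..1} \<Longrightarrow> b \<in> {0..1} \<Longrightarrow> \<bar>f b - f a - (b - a) * f1 a\<bar> \<le> K1 * (b - a)\<^sup>2"
    by (rule taylor_unit_interval[OF f(1,2) cont(2)]) auto
  obtain K2 where K2: "0 \<le> K2" "\<And>a b. a \<in> {0..1} \<Longrightarrow> b \<in> {0..1} \<Longrightarrow> \<bar>\<phi> b - \<phi> a - (b - a) * \<phi>1 a\<bar> \<le> K2 * (b - a)\<^sup>2"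
    "\<And>a b. a \<in> {0..1} \<Longrightarrow> b \<in> {0..1} \<Longrightarrow> \<bar>\<phi>1 b - \<phi>1 a\<bar> \<le> K2 * \<bar>b - a\<bar>"
    by (rule taylor_unit_interval[OF \<phi> cont(6)]) auto
  obtain K3 where K3: "0 \<le> K3" "\<And>a b. a \<in> {0..1} \<Longrightarrow> b \<in> {0..1} \<Longrightarrow> \<bar>D b - D a - (b - a) * D1 a\<bar> \<le> K3 * (b - a)\<^sup>2"
    by (rule taylor_unit_interval[OF D D2]) auto
  obtain K4 where K4: "0 \<le> K4" "\<And>a. a \<in> {0..1} \<Longrightarrow> \<bar>f1 a\<bar> \<le> K4"
    by (rule bounded_on_unit_interval[OF cont(1)]) auto
  obtain K5 where K5: "0 \<le> K5" "\<And>a. a \<in> {0..1} \<Longrightarrow> \<bar>\<phi> a\<bar> \<le> K5"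
    by (rule bounded_on_unit_interval[OF cont(4)]) auto
  obtain K6 where K6: "0 \<le> K6" "\<And>a. a \<in> {0..1} \<Longrightarrow> \<bar>\<phi>1 a\<bar> \<le> K6"
    by (rule bounded_on_unit_interval[OF cont(5)]) auto
  define K where "K = K1 + K2 + K3 + K4 + K5 + K6"
  have K: "K1 \<le> K" "K2 \<le> K" "K3 \<le> K" "K4 \<le> K" "K5 \<le> K" "K6 \<le> K"
    using K1(1) K2(1) K3(1) K4(1) K5(1) K6(1) by (auto simp: K_def)
  have p01: "p \<in> {0..1}" using p by auto
  have cA: "continuous_on {0..1} (\<lambda>a. f a + entropy_fn a)"
    unfolding f_def by (intro continuous_on_add continuous_on_entropy_fn) (auto simp: four_spin_f_def[abs_def] intro!: continuous_intros)
  have gap: "\<exists>\<eta>>0. \<forall>a\<in>{0..1}. \<bar>a - p\<bar> \<ge> \<delta> \<longrightarrow> \<bar>a - (1 - p)\<bar> \<ge> \<delta> \<longrightarrow>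
                f a + entropy_fn a \<le> f p + entropy_fn p - \<eta>" if \<delta>: "\<delta> > 0" for \<delta>
  proof -
    \<comment> \<open>The free energy attains its supremum on this compact set at a point that is
      not a global maximizer, so the gap is strict. For large \<open>\<delta>\<close> the set is
      empty and any positive gap will do.\<close>
    define S where "S = {0..1} \<inter> ({a. \<delta> \<le> \<bar>a - p\<bar>} \<inter> {a. \<delta> \<le> \<bar>a - (1 - p)\<bar>})"
    have S: "compact S" unfolding S_def
      by (intro compact_Int_closed compact_Icc closed_Int closed_Collect_le continuous_intros)
    show ?thesis
    proof (cases "S = {}")
      case True
      thus ?thesis by (intro exI[of _ 1]) (auto simp: S_def)
    next
      case False
      have "S \<subseteq> {0..1}" by (auto simp: S_def)
      then obtain m where m: "m \<in> S" "\<forall>a\<in>S. f a + entropy_fn a \<le> f m + entropy_fn m"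
        using continuous_attains_sup[OF S False continuous_on_subset[OF cA]] by blast
      have "m \<notin> {am, p}" using m(1) \<delta> by (auto simp: S_def am_eq)
      hence "m \<notin> maximizers \<beta> h" using max by simp
      then obtain y where y: "y \<in> {0..1}" "free_energy \<beta> h m < free_energy \<beta> h y"
        using m(1) unfolding maximizers_iff by (auto simp: S_def not_le)
      hence "free_energy \<beta> h m < free_energy \<beta> h p" using pmax[OF y(1)] by linarith
      hence lt: "f m + entropy_fn m < f p + entropy_fn p" by (simp add: free_energy_def f_def)
      show ?thesis
        by (rule exI[of _ "(f p + entropy_fn p) - (f m + entropy_fn m)"]) (use lt m(2) in \<open>auto simp: S_def\<close>)
    qed
  qed
  have "double_well f f1 \<phi> \<phi>1 p (D1 p) K"
  proof
    show "1 / 2 < p" "p < 1" "D1 p < 0" by fact+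
    show "f (1 - a) = f a" "\<phi> (1 - a) = \<phi> a" for a
      by (simp_all add: f_def \<phi>_def four_spin_f_reflect)
    show "\<bar>f b - f a - (b - a) * f1 a\<bar> \<le> K * (b - a)\<^sup>2" if "a \<in> {0..1}" "b \<in> {0..1}" for a b
      using K1(2)[OF that] mult_right_mono[OF K(1) zero_le_power2] by (rule order.trans)
    show "\<bar>\<phi> b - \<phi> a - (b - a) * \<phi>1 a\<bar> \<le> K * (b - a)\<^sup>2" if "a \<in> {0..1}" "b \<in> {0..1}" for a b
      using K2(2)[OF that] mult_right_mono[OF K(2) zero_le_power2] by (rule order.trans)
    show "\<bar>f1 a\<bar> \<le> K" if "a \<in> {0..1}" for a
      using K4(2)[OF that] K(4) by (rule order.trans)
    show "\<bar>\<phi> a\<bar> \<le> K" if "a \<in> {0..1}" for a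
      using K5(2)[OF that] K(5) by (rule order.trans)
    show "\<bar>\<phi>1 a\<bar> \<le> K" if "a \<in> {0..1}" for a
      using K6(2)[OF that] K(6) by (rule order.trans)
    show "\<bar>\<phi>1 a - \<phi>1 p\<bar> \<le> K * \<bar>a - p\<bar>" if "a \<in> {0..1}" for a
      using K2(3)[OF p01 that] mult_right_mono[OF K(2) abs_ge_zero] by (rule order.trans)
    show "\<phi> p = 0" by (simp add: \<phi>_def)
    show "\<phi>1 p \<noteq> 0"
    proof -
      have m: "2 * p - 1 > 0" using p by simp
      have "8 * b * (2 * p - 1) ^ 3 + 4 * c * (2 * p - 1) > 0"
      proof (cases "b = 0")
        case True thus ?thesis using bc m by simp
      next
        case False thus ?thesis using bc m by (intro add_pos_nonneg) auto
      qed
      thus ?thesis by (simp add: \<phi>1_def)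
    qed
    show "\<bar>(1 - a) * exp (f1 a) - a - D1 p * (a - p)\<bar> \<le> K * (a - p)\<^sup>2" if "a \<in> {0..1}" for a
    proof -
      have "\<bar>D a - D p - (a - p) * D1 p\<bar> \<le> K * (a - p)\<^sup>2"
        using K3(2)[OF p01 that] mult_right_mono[OF K(3) zero_le_power2] by (rule order.trans)
      thus ?thesis unfolding Dp by (simp add: D_def mult.commute)
    qed
    show "\<exists>\<eta>>0. \<forall>a\<in>{0..1}. \<bar>a - p\<bar> \<ge> \<delta> \<longrightarrow> \<bar>a - (1 - p)\<bar> \<ge> \<delta> \<longrightarrow>
                f a + entropy_fn a \<le> f p + entropy_fn p - \<eta>" if "\<delta> > 0" for \<delta>
      by (rule gap[OF that])
    show "isCont (\<lambda>a. f a + entropy_fn a) p"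
      using continuous_on_interior[OF cA, of p] p by simp
  qed
  hence "four_spin_well \<beta> h b c f1 \<phi>1 p (D1 p) K"
    unfolding f_def \<phi>_def using bc by (intro four_spin_well.intro) (auto simp: four_spin_well_axioms_def)
  thus ?thesis unfolding f1_def \<phi>1_def by (rule that)
qed

section \<open>Both likelihood equations as one moment equation, with the unknown recentered at the
  true parameter\<close>

definition moment_eq :: "real \<Rightarrow> real \<Rightarrow> real \<Rightarrow> real \<Rightarrow> nat \<Rightarrow> (nat \<Rightarrow> int) \<Rightarrow> real \<Rightarrow> bool" where
  "moment_eq b c \<beta> h n \<omega> \<theta> \<longleftrightarrow>
     (\<integral>\<eta>. four_spin_f b c (frac_plus n \<eta>) \<partial>four_spin_measure n (\<beta> + b * \<theta>) (h + c * \<theta>)) = four_spin_f b c (frac_plus n \<omega>)"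

definition is_moment_estimator :: "real \<Rightarrow> real \<Rightarrow> real \<Rightarrow> real \<Rightarrow> (nat \<Rightarrow> (nat \<Rightarrow> int) \<Rightarrow> real) \<Rightarrow> bool" where
  "is_moment_estimator b c \<beta> h est \<longleftrightarrow>
     (\<forall>n. \<forall>\<omega>\<in>spins n. (\<exists>!\<theta>. moment_eq b c \<beta> h n \<omega> \<theta>) \<longrightarrow> moment_eq b c \<beta> h n \<omega> (est n \<omega>))"

text \<open>The variance is produced before the estimator is given, because the constants of the
  limit law must be the same for every version of the estimator.\<close>

lemma estimator_weak_conv:
  assumes g: "phase_threshold g" "(\<beta>, h) \<in> R2 g" and bc: "0 \<le> b" "0 \<le> c" "0 < b + c"
  obtains v where "0 < v"
    "\<And>est. is_moment_estimator b c \<beta> h est \<Longrightarrow>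
     weak_conv_m (\<lambda>n. distr (four_spin_measure n \<beta> h) borel (\<lambda>\<omega>. sqrt (real n) * est n \<omega>))
       (half_normal_mixture (1 / 2) v (1 / 2) v)"
proof -
  have "\<beta> > 0" "h > g \<beta>" using g(2) by (auto simp: R2_def)
  then obtain am p where p: "am < 1 / 2" "1 / 2 < p" "p < 1" "maximizers \<beta> h = {am, p}"
      "deriv (deriv (free_energy \<beta> h)) p < 0"
    using g(1) unfolding phase_threshold_def by blast
  obtain \<kappa> K where "four_spin_well \<beta> h b c (\<lambda>a. 8 * \<beta> * (2 * a - 1) ^ 3 + 4 * h * (2 * a - 1))
     (\<lambda>a. 8 * b * (2 * a - 1) ^ 3 + 4 * c * (2 * a - 1)) p \<kappa> K"
    by (rule four_spin_well_of_maximizers[OF p(4,2,3,1,5) bc])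
  then interpret four_spin_well \<beta> h b c "\<lambda>a. 8 * \<beta> * (2 * a - 1) ^ 3 + 4 * h * (2 * a - 1)"
     "\<lambda>a. 8 * b * (2 * a - 1) ^ 3 + 4 * c * (2 * a - 1)" p \<kappa> K .
  define v where "v = 1 / \<sigma>2"
  have v: "v > 0" "sqrt v = 1 / sqrt \<sigma>2" using \<sigma>2_pos by (auto simp: v_def real_sqrt_divide)
  show ?thesis
  proof (rule that[OF v(1)])
    fix est :: "nat \<Rightarrow> (nat \<Rightarrow> int) \<Rightarrow> real"
    assume est: "is_moment_estimator b c \<beta> h est"
    show "weak_conv_m (\<lambda>n. distr (four_spin_measure n \<beta> h) borel (\<lambda>\<omega>. sqrt (real n) * est n \<omega>))
       (half_normal_mixture (1 / 2) v (1 / 2) v)"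
      unfolding weak_conv_m_def weak_conv_def
    proof (intro allI impI)
      fix t
      have "cdf (distr (four_spin_measure n \<beta> h) borel (\<lambda>\<omega>. sqrt (real n) * est n \<omega>)) t
          = measure (four_spin_measure n \<beta> h) {\<omega> \<in> spins n. sqrt (real n) * est n \<omega> \<le> t}" for n
      proof -
        have "(\<lambda>\<omega>. sqrt (real n) * est n \<omega>) -` {..t} \<inter> spins n = {\<omega> \<in> spins n. sqrt (real n) * est n \<omega> \<le> t}" by auto
        thus ?thesis unfolding cdf_def by (subst measure_distr) auto
      qed
      moreover have "cdf (half_normal_mixture (1 / 2) v (1 / 2) v) t = cdf std_normal_distribution (sqrt \<sigma>2 * t)"
        using measure_centered_normal_atMost[OF v(1), of t] emeasure_half_normal_mixture_half[OF v(1), of "{..t}"]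
        unfolding cdf_def measure_def v(2) by (simp add: mult.commute)
      moreover have "(\<lambda>n. measure (four_spin_measure n \<beta> h) {\<omega> \<in> spins n. sqrt (real n) * est n \<omega> \<le> t})
         \<longlonglongrightarrow> cdf std_normal_distribution (sqrt \<sigma>2 * t)"
        by (rule estimator_cdf_tendsto) (use est in \<open>simp add: is_moment_estimator_def moment_eq_def mean_def\<close>)
      ultimately show "(\<lambda>n. cdf (distr (four_spin_measure n \<beta> h) borel (\<lambda>\<omega>. sqrt (real n) * est n \<omega>)) t)
          \<longlonglongrightarrow> cdf (half_normal_mixture (1 / 2) v (1 / 2) v) t" by simp
    qed
  qed
qed

lemma Ex1_shift: "(\<exists>!x. P x) \<longleftrightarrow> (\<exists>!\<theta>::real. P (a + \<theta>))"
proof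
  assume "\<exists>!x. P x"
  then obtain x where x: "P x" "\<forall>y. P y \<longrightarrow> y = x" by blast
  show "\<exists>!\<theta>. P (a + \<theta>)"
  proof (rule ex1I[of _ "x - a"])
    have "a + (x - a) = x" by simp
    with x(1) show "P (a + (x - a))" by (simp only:)
    show "\<theta> = x - a" if "P (a + \<theta>)" for \<theta>
    proof -
      have "a + \<theta> = x" using x(2) that by blast
      thus ?thesis by linarith
    qed
  qed
next
  assume "\<exists>!\<theta>. P (a + \<theta>)"
  then obtain x where x: "P (a + x)" "\<forall>y. P (a + y) \<longrightarrow> y = x" by blast
  show "\<exists>!x. P x"
  proof (rule ex1I[of _ "a + x"])
    show "y = a + x" if "P y" for y
    proof -
      have "a + (y - a) = y" by simp
      with that have "P (a + (y - a))" by (simp only:)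
      hence "y - a = x" using x(2) by blast
      thus ?thesis by linarith
    qed
  qed (rule x)
qed

theorem theorem5p7:
  fixes g :: "real \<Rightarrow> real" and \<beta> h :: real
  assumes "phase_threshold g" and "(\<beta>, h) \<in> R2 g"
  shows "(\<exists>pm pp vm vp. pm > 0 \<and> pp > 0 \<and> pm + pp \<le> 1 \<and> vm > 0 \<and> vp > 0 \<and>
            (\<forall>bhat. is_mle_beta h bhat \<longrightarrow>
               weak_conv_m
                 (\<lambda>n. distr (four_spin_measure n \<beta> h) borel (\<lambda>\<omega>. sqrt (real n) * (bhat n \<omega> - \<beta>)))
                 (half_normal_mixture pm vm pp vp))) \<and>
         (\<exists>pm pp vm vp. pm > 0 \<and> pp > 0 \<and> pm + pp \<le> 1 \<and> vm > 0 \<and> vp > 0 \<and>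
            (\<forall>hhat. is_mle_h \<beta> hhat \<longrightarrow>
               weak_conv_m
                 (\<lambda>n. distr (four_spin_measure n \<beta> h) borel (\<lambda>\<omega>. sqrt (real n) * (hhat n \<omega> - h)))
                 (half_normal_mixture pm vm pp vp)))"
proof (rule conjI)
  show "\<exists>pm pp vm vp. pm > 0 \<and> pp > 0 \<and> pm + pp \<le> 1 \<and> vm > 0 \<and> vp > 0 \<and>
            (\<forall>bhat. is_mle_beta h bhat \<longrightarrow>
               weak_conv_m
                 (\<lambda>n. distr (four_spin_measure n \<beta> h) borel (\<lambda>\<omega>. sqrt (real n) * (bhat n \<omega> - \<beta>)))
                 (half_normal_mixture pm vm pp vp))"
  proof (rule estimator_weak_conv[OF assms zero_le_one order.refl])
    show "0 < (1::real) + 0" by simp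
    fix v :: real
    assume v: "0 < v" "\<And>est. is_moment_estimator 1 0 \<beta> h est \<Longrightarrow>
     weak_conv_m (\<lambda>n. distr (four_spin_measure n \<beta> h) borel (\<lambda>\<omega>. sqrt (real n) * est n \<omega>))
       (half_normal_mixture (1 / 2) v (1 / 2) v)"
    have "is_moment_estimator 1 0 \<beta> h (\<lambda>n \<omega>. bhat n \<omega> - \<beta>)" if "is_mle_beta h bhat" for bhat
    proof -
      \<comment> \<open>In direction (1, 0) the statistic is the fourth power of the magnetization;
        below, direction (0, 1) gives its square. Existence and uniqueness of the solution survive
        the translation by the true parameter.\<close>
      have eq: "moment_eq 1 0 \<beta> h n \<omega> \<theta> \<longleftrightarrow> mle_eq_beta n h \<omega> (\<beta> + \<theta>)" for n \<omega> \<theta>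
        by (simp add: mle_eq_beta_def moment_eq_def four_spin_f_def magnetization_def)
      show ?thesis
        using that Ex1_shift[of "mle_eq_beta n h \<omega>" \<beta> for n \<omega>]
        unfolding is_mle_beta_def is_moment_estimator_def eq by simp
    qed
    note this[THEN v(2)]
    with v(1) show ?thesis
      by (intro exI[of _ "1 / 2"] exI[of _ v]) simp
  qed
next
  show "\<exists>pm pp vm vp. pm > 0 \<and> pp > 0 \<and> pm + pp \<le> 1 \<and> vm > 0 \<and> vp > 0 \<and>
            (\<forall>hhat. is_mle_h \<beta> hhat \<longrightarrow>
               weak_conv_m
                 (\<lambda>n. distr (four_spin_measure n \<beta> h) borel (\<lambda>\<omega>. sqrt (real n) * (hhat n \<omega> - h)))
                 (half_normal_mixture pm vm pp vp))"
  proof (rule estimator_weak_conv[OF assms order.refl zero_le_one])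
    show "0 < (0::real) + 1" by simp
    fix v :: real
    assume v: "0 < v" "\<And>est. is_moment_estimator 0 1 \<beta> h est \<Longrightarrow>
     weak_conv_m (\<lambda>n. distr (four_spin_measure n \<beta> h) borel (\<lambda>\<omega>. sqrt (real n) * est n \<omega>))
       (half_normal_mixture (1 / 2) v (1 / 2) v)"
    have "is_moment_estimator 0 1 \<beta> h (\<lambda>n \<omega>. hhat n \<omega> - h)" if "is_mle_h \<beta> hhat" for hhat
    proof -
      have eq: "moment_eq 0 1 \<beta> h n \<omega> \<theta> \<longleftrightarrow> mle_eq_h n \<beta> \<omega> (h + \<theta>)" for n \<omega> \<theta>
        by (simp add: mle_eq_h_def moment_eq_def four_spin_f_def magnetization_def)
      show ?thesis
        using that Ex1_shift[of "mle_eq_h n \<beta> \<omega>" h for n \<omega>]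
        unfolding is_mle_h_def is_moment_estimator_def eq by simp
    qed
    note this[THEN v(2)]
    with v(1) show ?thesis
      by (intro exI[of _ "1 / 2"] exI[of _ v]) simp
  qed
qed

end
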